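(* Let $X \in 2^\omega$. The following are equivalent: (i) $X$ is not Schnorr random. (ii) There is a bounded Schnorr open set $\mathcal{U} \subseteq 2^\omega$ such that all tails of $X$ belong to $\mathcal{U}$. (iii) $X \in U^\omega$ for some bounded Schnorr prefix-free subset $U$ of $2^{<\omega}$.
   Context: $2^\omega$ is Cantor space (infinite binary sequences), $2^{<\omega}$ the set of finite binary strings, $\mu$ the uniform (Lebesgue) measure on $2^\omega$. For a string $\sigma$, $[\sigma]$ is the set of infinite sequences with prefix $\sigma$; for $U \subseteq 2^{<\omega}$, $[U]=\bigcup_{\sigma\in U}[\sigma]$, and if $U$ is prefix-free its measure is $\mu(U)=\mu([U])=\sum_{\sigma\in U}2^{-|\sigma|}$. A c.e. open set is a set of the form $[U]$ with $U$ a c.e. prefix-free set of strings. A c.e. open set (resp. c.e. prefix-free set of strings) is called a Schnorr set if its measure is a computable real. An open set (resp. prefix-free set of strings) is bounded if its measure is smaller than $1$. A tail of $X$ is any sequence $X(k)X(k+1)X(k+2)\ldots$ with $k \in \mathbb{N}$. For $S\subseteq 2^{<\omega}$, $S^\omega$ is the set of $A\in 2^\omega$ of the form $A=\sigma_0\sigma_1\sigma_2\ldots$ with all $\sigma_i \in S$. A Schnorr test is a non-increasing sequence $(\mathcal{U}_n)_{n\in\mathbb{N}}$ of uniformly c.e. open sets with $\mu(\mathcal{U}_n)=2^{-n}$ for all $n$. $X$ is Schnorr random if for every Schnorr test $(\mathcal{U}_n)_{n\in\mathbb{N}}$, $X \notin \bigcap_n \mathcal{U}_n$. *)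

theory Defs
  imports "HOL-Probability.Probability" "HOL-Library.Sublist" "HOL-Library.Nat_Bijection"
begin

section \<open>Recursive functions\<close>

text \<open>
  \<open>recursive n f\<close>: \<open>f\<close>, restricted to lists of length \<open>n\<close>, is a total \<open>n\<close>-ary recursive function.
  Minimisation is applied to regular functions only, so all functions are total; by Kleene's normal
  form theorem this yields exactly the total computable functions.  By rule \<open>ext\<close> the values of
  \<open>f\<close> on lists of other lengths are irrelevant.
\<close>

inductive recursive :: "nat \<Rightarrow> (nat list \<Rightarrow> nat) \<Rightarrow> bool" where
  zero: "recursive n (\<lambda>xs. 0)"
| succ: "recursive 1 (\<lambda>xs. Suc (xs ! 0))"
| proj: "i < n \<Longrightarrow> recursive n (\<lambda>xs. xs ! i)"
| comp: "recursive (length fs) g \<Longrightarrow> (\<And>f. f \<in> set fs \<Longrightarrow> recursive n f)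
    \<Longrightarrow> recursive n (\<lambda>xs. g (map (\<lambda>f. f xs) fs))"
| prec: "recursive n f \<Longrightarrow> recursive (Suc (Suc n)) g
    \<Longrightarrow> recursive (Suc n) (\<lambda>xs. rec_nat (f (tl xs)) (\<lambda>k r. g (k # r # tl xs)) (hd xs))"
| minim: "recursive (Suc n) f \<Longrightarrow> (\<And>xs. length xs = n \<Longrightarrow> \<exists>y. f (y # xs) = 0)
    \<Longrightarrow> recursive n (\<lambda>xs. LEAST y. f (y # xs) = 0)"
| ext: "recursive n f \<Longrightarrow> (\<And>xs. length xs = n \<Longrightarrow> f xs = g xs) \<Longrightarrow> recursive n g"

definition computable :: "(nat \<Rightarrow> nat) \<Rightarrow> bool" where
  "computable f \<longleftrightarrow> recursive 1 (\<lambda>xs. f (xs ! 0))"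

definition ce :: "nat set \<Rightarrow> bool" where
  "ce A \<longleftrightarrow> A = {} \<or> (\<exists>f. computable f \<and> A = range f)"

text \<open>A real is computable if some computable sequence of rationals converges to it with error
  at most \<open>2\<^sup>-\<^sup>n\<close> at stage \<open>n\<close>; the rationals are given as \<open>(a - b) / (c + 1)\<close> with \<open>a, b, c\<close> natural.\<close>

definition computable_real :: "real \<Rightarrow> bool" where
  "computable_real x \<longleftrightarrow> (\<exists>a b c. computable a \<and> computable b \<and> computable c \<and>
     (\<forall>n. \<bar>x - (real (a n) - real (b n)) / (real (c n) + 1)\<bar> \<le> (1 / 2) ^ n))"

section \<open>Strings and Cantor space\<close>

text \<open>Bijective base-2 numeration, least significant digit first; a bijection from the strings
  onto the natural numbers.\<close>

fun str_code :: "bool list \<Rightarrow> nat" where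
  "str_code [] = 0"
| "str_code (b # \<sigma>) = 2 * str_code \<sigma> + (if b then 2 else 1)"

definition prefix_free :: "bool list set \<Rightarrow> bool" where
  "prefix_free U \<longleftrightarrow> (\<forall>\<sigma>\<in>U. \<forall>\<tau>\<in>U. prefix \<sigma> \<tau> \<longrightarrow> \<sigma> = \<tau>)"

definition cylinder :: "bool list \<Rightarrow> (nat \<Rightarrow> bool) set" where
  "cylinder \<sigma> = {X. \<forall>i<length \<sigma>. X i = \<sigma> ! i}"

definition open_of :: "bool list set \<Rightarrow> (nat \<Rightarrow> bool) set" where
  "open_of U = (\<Union>\<sigma>\<in>U. cylinder \<sigma>)"

definition cantor :: "(nat \<Rightarrow> bool) measure" where
  "cantor = Pi\<^sub>M UNIV (\<lambda>_. measure_pmf (bernoulli_pmf (1 / 2)))"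

definition tail :: "nat \<Rightarrow> (nat \<Rightarrow> bool) \<Rightarrow> (nat \<Rightarrow> bool)" where
  "tail k X = (\<lambda>i. X (k + i))"

text \<open>\<open>A = \<sigma>\<^sub>0\<sigma>\<^sub>1\<sigma>\<^sub>2\<dots>\<close>: every finite concatenation is a prefix of \<open>A\<close>, and their lengths are
  unbounded, so that the concatenation is an infinite sequence even if some \<open>\<sigma>\<^sub>i\<close> are empty.\<close>

definition omega_power :: "bool list set \<Rightarrow> (nat \<Rightarrow> bool) set" where
  "omega_power S = {A. \<exists>\<sigma>. (\<forall>i. \<sigma> i \<in> S) \<and>
     (\<forall>n. A \<in> cylinder (concat (map \<sigma> [0..<n]))) \<and>
     (\<forall>m. \<exists>n. m \<le> length (concat (map \<sigma> [0..<n])))}"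

section \<open>Schnorr sets and Schnorr randomness\<close>

definition ce_strings :: "bool list set \<Rightarrow> bool" where
  "ce_strings U \<longleftrightarrow> ce (str_code ` U)"

definition ce_open :: "(nat \<Rightarrow> bool) set \<Rightarrow> bool" where
  "ce_open \<U> \<longleftrightarrow> (\<exists>U. ce_strings U \<and> prefix_free U \<and> \<U> = open_of U)"

definition schnorr_open :: "(nat \<Rightarrow> bool) set \<Rightarrow> bool" where
  "schnorr_open \<U> \<longleftrightarrow> ce_open \<U> \<and> computable_real (measure cantor \<U>)"

definition bounded_open :: "(nat \<Rightarrow> bool) set \<Rightarrow> bool" where
  "bounded_open \<U> \<longleftrightarrow> measure cantor \<U> < 1"

definition schnorr_prefix_free :: "bool list set \<Rightarrow> bool" where
  "schnorr_prefix_free U \<longleftrightarrow>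
     ce_strings U \<and> prefix_free U \<and> computable_real (measure cantor (open_of U))"

definition bounded_strings :: "bool list set \<Rightarrow> bool" where
  "bounded_strings U \<longleftrightarrow> measure cantor (open_of U) < 1"

definition uniformly_ce_open :: "(nat \<Rightarrow> (nat \<Rightarrow> bool) set) \<Rightarrow> bool" where
  "uniformly_ce_open \<U> \<longleftrightarrow>
     (\<exists>U. ce {prod_encode (n, str_code \<sigma>) |n \<sigma>. \<sigma> \<in> U n} \<and>
          (\<forall>n. prefix_free (U n) \<and> \<U> n = open_of (U n)))"

definition schnorr_test :: "(nat \<Rightarrow> (nat \<Rightarrow> bool) set) \<Rightarrow> bool" where
  "schnorr_test \<U> \<longleftrightarrow>
     decseq \<U> \<and> uniformly_ce_open \<U> \<and> (\<forall>n. measure cantor (\<U> n) = (1 / 2) ^ n)"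

definition schnorr_random :: "(nat \<Rightarrow> bool) \<Rightarrow> bool" where
  "schnorr_random X \<longleftrightarrow> (\<forall>\<U>. schnorr_test \<U> \<longrightarrow> X \<notin> (\<Inter>n. \<U> n))"

end

theory Submission
  imports Defs
begin

text \<open>
  The three conditions are linked in a circle.

  From a Schnorr test to a bounded Schnorr open set containing all tails (\<open>test_imp_tails\<close>): deleting
  \<open>k\<close> bits enlarges an open set at most by the factor \<open>2 ^ k\<close> (\<open>tail_image\<close>).  So the \<open>k\<close>-tails of a
  sufficiently late member of the test form a set whose measure is a small multiple of \<open>(1 / 2) ^ k\<close>,
  and the union of these sets over \<open>k\<close> is still bounded.

  From a set containing all tails to \<open>U\<^sup>\<omega>\<close> (\<open>tails_imp_omega_power\<close>): for a prefix-free set \<open>U\<close> of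
  generators, strings of \<open>U\<close> are split off greedily, because every remainder is a tail of \<open>X\<close>.

  From \<open>U\<^sup>\<omega>\<close> to a Schnorr test (\<open>omega_power_imp_test\<close>): the sequences starting with \<open>m\<close> strings of \<open>U\<close>
  form an open set of measure \<open>q ^ m\<close>, where \<open>q < 1\<close> is the measure of \<open>U\<close>.  These sets decrease and
  their measures tend to \<open>0\<close> at a computable rate.  A test needs measure exactly \<open>(1 / 2) ^ n\<close>, which is
  achieved by adding a lexicographic initial segment of Cantor space (\<open>measure_pad\<close>); this respects
  inclusion if the sets have at most half the target measure (\<open>pad_decreasing\<close>).

  The effective content is uniform.  A computable measure means that one can compute how long to
  enumerate a c.e. open set until the missing part is small (\<open>modulus_exists\<close>).  Hence every open set
  is handled as a union of decidable clopen stages with a known error.  Such a presentation yields a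
  c.e. prefix-free set of generators (\<open>uniformly_ce_open_stages\<close>) and, by counting strings, a
  computable measure (\<open>computable_real_stages\<close>).
\<close>

section \<open>Closure properties of computable functions\<close>

text \<open>
  Computability is handled with unary functions only.  Several arguments are packed into one number
  by the pairing function, so that the side conditions on the lengths of argument lists disappear and
  closure under an operation becomes an introduction rule of the form
  \<open>computable f \<Longrightarrow> computable g \<Longrightarrow> computable (\<lambda>z. op (f z) (g z))\<close>.  A bound variable becomes
  the first component of the argument and the old argument the second.  With all rules in
  \<open>comp_intros\<close>, computability of a concrete expression follows by backward chaining on its syntax.
\<close>

named_theorems comp_intros

text \<open>
  The next lemmas produce just enough list-based recursive functions to make pairing and its two
  projections computable; after that only unary functions occur.
\<close>

lemma recursive_comp1:
  assumes "recursive 1 (\<lambda>xs. h (xs ! 0))" "recursive n f"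
  shows "recursive n (\<lambda>xs. h (f xs))"
  using recursive.comp[of "[f]" "\<lambda>xs. h (xs ! 0)" n] assms by simp

lemma recursive_comp2:
  assumes "recursive 2 (\<lambda>xs. h (xs ! 0) (xs ! 1))" "recursive n f" "recursive n g"
  shows "recursive n (\<lambda>xs. h (f xs) (g xs))"
proof -
  have "recursive n (\<lambda>xs. (\<lambda>xs. h (xs ! 0) (xs ! 1)) (map (\<lambda>f. f xs) [f, g]))"
    by (rule recursive.comp) (use assms in \<open>auto simp: numeral_2_eq_2\<close>)
  then show ?thesis by simp
qed

lemma recursive_prec:
  assumes "recursive 1 (\<lambda>xs. f (xs ! 0))" "recursive 3 (\<lambda>xs. g (xs ! 0) (xs ! 1) (xs ! 2))"
  shows "recursive 2 (\<lambda>xs. rec_nat (f (xs ! 1)) (\<lambda>k r. g k r (xs ! 1)) (xs ! 0))"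
proof -
  have "recursive (Suc 1) (\<lambda>xs. rec_nat ((\<lambda>xs. f (xs ! 0)) (tl xs))
      (\<lambda>k r. (\<lambda>xs. g (xs ! 0) (xs ! 1) (xs ! 2)) (k # r # tl xs)) (hd xs))"
    by (rule recursive.prec) (use assms in \<open>auto simp: numeral_3_eq_3 numeral_2_eq_2\<close>)
  then have "recursive 2 (\<lambda>xs. rec_nat ((\<lambda>xs. f (xs ! 0)) (tl xs))
      (\<lambda>k r. (\<lambda>xs. g (xs ! 0) (xs ! 1) (xs ! 2)) (k # r # tl xs)) (hd xs))"
    by (simp add: numeral_2_eq_2)
  then show ?thesis
  proof (rule recursive.ext)
    fix xs :: "nat list" assume "length xs = 2"
    then obtain a b where "xs = [a, b]"
      by (auto simp: numeral_2_eq_2 length_Suc_conv)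
    then show "rec_nat ((\<lambda>xs. f (xs ! 0)) (tl xs))
      (\<lambda>k r. (\<lambda>xs. g (xs ! 0) (xs ! 1) (xs ! 2)) (k # r # tl xs)) (hd xs) =
      rec_nat (f (xs ! 1)) (\<lambda>k r. g k r (xs ! 1)) (xs ! 0)"
      by (simp add: numeral_2_eq_2)
  qed
qed

lemma recursive_swap:
  assumes "recursive 2 (\<lambda>xs. h (xs ! 0) (xs ! 1))"
  shows "recursive 2 (\<lambda>xs. h (xs ! 1) (xs ! 0))"
  by (rule recursive_comp2[OF assms]) (auto intro: recursive.proj)

lemma recursive_Suc: "recursive n f \<Longrightarrow> recursive n (\<lambda>xs. Suc (f xs))"
  by (rule recursive_comp1[OF recursive.succ])

lemma recursive_add: "recursive 2 (\<lambda>xs. xs ! 0 + xs ! 1)"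
proof -
  have "recursive 2 (\<lambda>xs. rec_nat (xs ! 1) (\<lambda>k r. Suc r) (xs ! 0))"
    by (rule recursive_prec) (auto intro!: recursive.proj recursive_Suc)
  moreover have "rec_nat y (\<lambda>k r. Suc r) x = x + y" for x y :: nat
    by (induction x) auto
  ultimately show ?thesis by simp
qed

lemma recursive_mult: "recursive 2 (\<lambda>xs. xs ! 0 * xs ! 1)"
proof -
  have "recursive 2 (\<lambda>xs. rec_nat 0 (\<lambda>k r. r + xs ! 1) (xs ! 0))"
    by (rule recursive_prec[where f = "\<lambda>_. 0" and g = "\<lambda>k r y. r + y"])
       (auto intro!: recursive.proj recursive.zero recursive_comp2[OF recursive_add])
  moreover have "rec_nat 0 (\<lambda>k r. r + y) x = x * y" for x y :: nat
    by (induction x) auto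
  ultimately show ?thesis by simp
qed

lemma recursive_pred: "recursive 1 (\<lambda>xs. xs ! 0 - 1)"
proof -
  have "recursive 2 (\<lambda>xs. rec_nat 0 (\<lambda>k r. k) (xs ! 0))"
    by (rule recursive_prec[where f = "\<lambda>_. 0" and g = "\<lambda>k r y. k"])
       (auto intro!: recursive.proj recursive.zero)
  moreover have "rec_nat 0 (\<lambda>k r. k) x = x - 1" for x :: nat
    by (cases x) auto
  ultimately have "recursive 2 (\<lambda>xs. xs ! 0 - 1)" by simp
  from recursive_comp2[where h = "\<lambda>x y. x - 1", OF this, of 1 "\<lambda>xs. xs ! 0" "\<lambda>xs. xs ! 0"]
  show ?thesis by (auto intro: recursive.proj)
qed

lemma recursive_diff: "recursive 2 (\<lambda>xs. xs ! 0 - xs ! 1)"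
proof -
  have "recursive 2 (\<lambda>xs. rec_nat (xs ! 1) (\<lambda>k r. r - 1) (xs ! 0))"
    by (rule recursive_prec[where f = "\<lambda>y. y" and g = "\<lambda>k r y. r - 1"])
       (auto intro!: recursive.proj recursive_comp1[OF recursive_pred, simplified])
  moreover have "rec_nat y (\<lambda>k r. r - 1) x = y - x" for x y :: nat
    by (induction x) auto
  ultimately have "recursive 2 (\<lambda>xs. xs ! 1 - xs ! 0)" by simp
  from recursive_swap[where h = "\<lambda>x y. y - x", OF this] show ?thesis .
qed

lemma recursive_triangle: "recursive 1 (\<lambda>xs. triangle (xs ! 0))"
proof -
  have "recursive 2 (\<lambda>xs. rec_nat 0 (\<lambda>k r. r + Suc k) (xs ! 0))"
    by (rule recursive_prec[where f = "\<lambda>_. 0" and g = "\<lambda>k r y. r + Suc k"])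
       (rule recursive.zero, intro recursive_comp2[OF recursive_add] recursive_Suc recursive.proj, auto)
  moreover have "rec_nat 0 (\<lambda>k r. r + Suc k) x = triangle x" for x :: nat
    by (induction x) auto
  ultimately have "recursive 2 (\<lambda>xs. triangle (xs ! 0))" by simp
  from recursive_comp2[where h = "\<lambda>x y. triangle x", OF this, of 1 "\<lambda>xs. xs ! 0" "\<lambda>xs. xs ! 0"]
  show ?thesis by (auto intro: recursive.proj)
qed

lemma computable_comp: "computable f \<Longrightarrow> computable g \<Longrightarrow> computable (\<lambda>z. f (g z))"
  unfolding computable_def by (rule recursive_comp1)

lemma computable_comp2:
  "recursive 2 (\<lambda>xs. h (xs ! 0) (xs ! 1)) \<Longrightarrow> computable f \<Longrightarrow> computable g \<Longrightarrow>
    computable (\<lambda>z. h (f z) (g z))"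
  unfolding computable_def by (rule recursive_comp2)

lemma computable_ident [comp_intros]: "computable (\<lambda>z. z)"
  unfolding computable_def by (auto intro: recursive.proj)

lemma computable_Suc [comp_intros]: "computable f \<Longrightarrow> computable (\<lambda>z. Suc (f z))"
  unfolding computable_def by (rule recursive_Suc)

lemma computable_const [comp_intros]: "computable (\<lambda>z. c)"
proof (induction c)
  case 0 then show ?case unfolding computable_def by (rule recursive.zero)
qed (rule computable_Suc)

lemmas computable_add [comp_intros] = computable_comp2[OF recursive_add]
lemmas computable_mult [comp_intros] = computable_comp2[OF recursive_mult]
lemmas computable_diff [comp_intros] = computable_comp2[OF recursive_diff]
lemmas computable_triangle = computable_comp[OF recursive_triangle[folded computable_def]]

lemma computable_pair [comp_intros]:
  "computable f \<Longrightarrow> computable g \<Longrightarrow> computable (\<lambda>z. prod_encode (f z, g z))"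
  unfolding prod_encode_def by (simp, intro computable_triangle comp_intros)

definition pfst :: "nat \<Rightarrow> nat" where "pfst z = fst (prod_decode z)"
definition psnd :: "nat \<Rightarrow> nat" where "psnd z = snd (prod_decode z)"

lemma pfst_pair [simp]: "pfst (prod_encode (a, b)) = a" by (simp add: pfst_def)
lemma psnd_pair [simp]: "psnd (prod_encode (a, b)) = b" by (simp add: psnd_def)
lemma pair_pfst_psnd [simp]: "prod_encode (pfst z, psnd z) = z" by (simp add: pfst_def psnd_def)

text \<open>
  A pair \<open>(a, b)\<close> is coded by \<open>triangle (a + b) + a\<close>, so the sum \<open>a + b\<close> is the index of the largest
  triangular number below the code, and it determines both components.  The index is written as a
  least zero of a truncated difference in order to be an instance of minimisation.
\<close>

definition triangle_root :: "nat \<Rightarrow> nat" where "triangle_root z = (LEAST w. Suc z - triangle (Suc w) = 0)"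

lemma le_triangle: "w \<le> triangle w"
  by (induction w) auto

lemma triangle_mono: "v \<le> w \<Longrightarrow> triangle v \<le> triangle w"
  by (induction w) (auto simp: le_Suc_eq)

lemma triangle_root_pair: "triangle_root (prod_encode (a, b)) = a + b"
  unfolding triangle_root_def
proof (rule Least_equality)
  fix y assume "Suc (prod_encode (a, b)) - triangle (Suc y) = 0"
  then have "prod_encode (a, b) < triangle (Suc y)" by simp
  then have "triangle (a + b) < triangle (Suc y)" by (simp add: prod_encode_def)
  then show "a + b \<le> y" using triangle_mono[of "Suc y" "a + b"] by (meson linorder_not_less not_less_eq_eq)
qed (simp add: prod_encode_def)

lemma computable_triangle_root: "computable triangle_root"
proof -
  have "recursive 2 (\<lambda>xs. Suc (xs ! 1) - triangle (Suc (xs ! 0)))"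
    by (intro recursive_comp2[OF recursive_diff] recursive_Suc recursive_comp1[OF recursive_triangle] recursive.proj)
      auto
  then have *: "recursive (Suc 1) (\<lambda>xs. Suc (xs ! 1) - triangle (Suc (xs ! 0)))"
    by (simp add: numeral_2_eq_2)
  have "\<exists>y. Suc ((y # xs) ! 1) - triangle (Suc ((y # xs) ! 0)) = 0" for xs
    using le_triangle[of "Suc (xs ! 0)"] by (intro exI[of _ "xs ! 0"]) (simp del: triangle_Suc)
  from recursive.minim[OF *, OF this]
  have "recursive 1 (\<lambda>xs. LEAST y. Suc ((y # xs) ! 1) - triangle (Suc ((y # xs) ! 0)) = 0)" .
  then show ?thesis by (simp add: computable_def triangle_root_def[abs_def])
qed

lemma pfst_eq: "pfst z = z - triangle (triangle_root z)"
proof -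
  obtain a b where "z = prod_encode (a, b)" by (metis pair_pfst_psnd)
  then show ?thesis by (simp only: triangle_root_pair pfst_pair) (simp add: prod_encode_def)
qed

lemma psnd_eq: "psnd z = triangle_root z - pfst z"
proof -
  obtain a b where "z = prod_encode (a, b)" by (metis pair_pfst_psnd)
  then show ?thesis by (simp add: triangle_root_pair)
qed

lemma computable_pfst [comp_intros]: "computable f \<Longrightarrow> computable (\<lambda>z. pfst (f z))"
  unfolding pfst_eq by (intro comp_intros computable_triangle computable_comp[OF computable_triangle_root])

lemma computable_psnd [comp_intros]: "computable f \<Longrightarrow> computable (\<lambda>z. psnd (f z))"
  unfolding psnd_eq by (intro comp_intros computable_comp[OF computable_triangle_root])

text \<open>
  Primitive recursion in which the step function may depend on the parameter \<open>e\<close>: the parameter is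
  carried along as third component of the argument of the step.
\<close>

lemma computable_rec_nat [comp_intros]:
  assumes "computable f" "computable (\<lambda>e. g (pfst e) (pfst (psnd e)) (psnd (psnd e)))" "computable b"
  shows "computable (\<lambda>e. rec_nat (f e) (\<lambda>k r. g k r e) (b e))"
proof -
  have P: "recursive 2 (\<lambda>xs. prod_encode (xs ! 0, xs ! 1))"
    unfolding prod_encode_def
    by (simp, intro recursive_comp2[OF recursive_add] recursive_comp1[OF recursive_triangle] recursive.proj) auto
  have "recursive 3 (\<lambda>xs. (\<lambda>e. g (pfst e) (pfst (psnd e)) (psnd (psnd e)))
      (prod_encode (xs ! 0, prod_encode (xs ! 1, xs ! 2))))"
    by (intro recursive_comp1[OF assms(2)[unfolded computable_def]] recursive_comp2[OF P] recursive.proj) auto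
  then have "recursive 2 (\<lambda>xs. rec_nat (f (xs ! 1)) (\<lambda>k r. g k r (xs ! 1)) (xs ! 0))"
    using assms(1) by (intro recursive_prec) (auto simp: computable_def)
  from computable_comp2[where h = "\<lambda>x y. rec_nat (f y) (\<lambda>k r. g k r y) x", OF this assms(3) computable_ident]
  show ?thesis .
qed

definition decidable :: "(nat \<Rightarrow> bool) \<Rightarrow> bool" where
  "decidable P \<longleftrightarrow> computable (\<lambda>z. of_bool (P z))"

lemma computable_of_bool [comp_intros]: "decidable P \<Longrightarrow> computable (\<lambda>z. of_bool (P z))"
  by (simp add: decidable_def)

lemma decidable_le [comp_intros]:
  "computable f \<Longrightarrow> computable g \<Longrightarrow> decidable (\<lambda>z. f z \<le> g z)"
proof -
  assume "computable f" "computable g"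
  then have "computable (\<lambda>z. 1 - (f z - g z))" by (intro comp_intros)
  moreover have "(\<lambda>z. 1 - (f z - g z)) = (\<lambda>z. of_bool (f z \<le> g z))" by (auto simp: fun_eq_iff)
  ultimately show ?thesis by (simp add: decidable_def)
qed

lemma decidable_not [comp_intros]: "decidable P \<Longrightarrow> decidable (\<lambda>z. \<not> P z)"
proof -
  assume "decidable P"
  then have "decidable (\<lambda>z. of_bool (P z) \<le> (0::nat))" by (intro comp_intros)
  then show ?thesis by simp
qed

lemma decidable_conj [comp_intros]: "decidable P \<Longrightarrow> decidable Q \<Longrightarrow> decidable (\<lambda>z. P z \<and> Q z)"
proof -
  assume "decidable P" "decidable Q"
  then have "computable (\<lambda>z. of_bool (P z) * of_bool (Q z))" by (intro comp_intros)
  then show ?thesis by (simp add: decidable_def of_bool_conj)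
qed

lemma decidable_disj [comp_intros]: "decidable P \<Longrightarrow> decidable Q \<Longrightarrow> decidable (\<lambda>z. P z \<or> Q z)"
proof -
  assume "decidable P" "decidable Q"
  then have "decidable (\<lambda>z. \<not> (\<not> P z \<and> \<not> Q z))" by (intro comp_intros)
  then show ?thesis by simp
qed

lemma decidable_less [comp_intros]:
  "computable f \<Longrightarrow> computable g \<Longrightarrow> decidable (\<lambda>z. f z < g z)"
  unfolding not_le[symmetric] by (intro comp_intros)

lemma decidable_eq [comp_intros]:
  "computable f \<Longrightarrow> computable g \<Longrightarrow> decidable (\<lambda>z. f z = g z)"
  unfolding order_eq_iff[where 'a = nat] by (intro comp_intros)

lemma computable_if [comp_intros]:
  assumes "decidable P" "computable f" "computable g"
  shows "computable (\<lambda>z. if P z then f z else g z)"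
proof -
  have "computable (\<lambda>z. of_bool (P z) * f z + of_bool (\<not> P z) * g z)"
    using assms by (intro comp_intros)
  moreover have "(\<lambda>z. of_bool (P z) * f z + of_bool (\<not> P z) * g z) = (\<lambda>z. if P z then f z else g z)"
    by auto
  ultimately show ?thesis by simp
qed

lemma computable_sum [comp_intros]:
  assumes "computable (\<lambda>e. h (pfst e) (psnd e))" "computable b"
  shows "computable (\<lambda>z. \<Sum>i<b z. h i z)"
proof -
  have "computable (\<lambda>z. rec_nat 0 (\<lambda>k r. r + h k z) (b z))"
    by (intro comp_intros assms computable_comp[OF assms(1),
      of "\<lambda>e. prod_encode (pfst e, psnd (psnd e))", simplified])
  moreover have "rec_nat 0 (\<lambda>k r. r + h k z) n = (\<Sum>i<n. h i z)" for z n
    by (induction n) auto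
  ultimately show ?thesis by simp
qed

lemma decidable_ex [comp_intros]:
  assumes "decidable (\<lambda>e. P (pfst e) (psnd e))" "computable b"
  shows "decidable (\<lambda>z. \<exists>i<b z. P i z)"
proof -
  have "decidable (\<lambda>z. 0 < (\<Sum>i<b z. of_bool (P i z) :: nat))"
    using assms by (intro comp_intros)
  moreover have "0 < (\<Sum>i<n. of_bool (P i z) :: nat) \<longleftrightarrow> (\<exists>i<n. P i z)" for n z
    by (induction n) (auto simp: less_Suc_eq)
  ultimately show ?thesis by simp
qed

lemma decidable_ex_le [comp_intros]:
  assumes "decidable (\<lambda>e. P (pfst e) (psnd e))" "computable b"
  shows "decidable (\<lambda>z. \<exists>i\<le>b z. P i z)"
  using decidable_ex[OF assms(1) computable_Suc[OF assms(2)]] by (simp add: less_Suc_eq_le)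

lemma decidable_all [comp_intros]:
  assumes "decidable (\<lambda>e. P (pfst e) (psnd e))" "computable b"
  shows "decidable (\<lambda>z. \<forall>i<b z. P i z)"
proof -
  have "decidable (\<lambda>z. \<not> (\<exists>i<b z. \<not> P i z))" by (intro comp_intros assms)
  then show ?thesis by simp
qed

lemma computable_least [comp_intros]:
  assumes "decidable (\<lambda>e. P (pfst e) (psnd e))" "\<And>z. \<exists>y. P y z"
  shows "computable (\<lambda>z. LEAST y. P y z)"
proof -
  let ?f = "\<lambda>e. of_bool (\<not> P (pfst e) (psnd e)) :: nat"
  have P: "recursive 2 (\<lambda>xs. prod_encode (xs ! 0, xs ! 1))"
    unfolding prod_encode_def
    by (simp, intro recursive_comp2[OF recursive_add] recursive_comp1[OF recursive_triangle] recursive.proj) auto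
  have "computable ?f" by (intro comp_intros assms)
  then have "recursive 2 (\<lambda>xs. ?f (prod_encode (xs ! 0, xs ! 1)))"
    unfolding computable_def
    by (rule recursive_comp1) (intro recursive_comp2[OF P] recursive.proj, auto)
  then have *: "recursive (Suc 1) (\<lambda>xs. ?f (prod_encode (xs ! 0, xs ! 1)))"
    by (simp add: numeral_2_eq_2)
  have "\<exists>y. ?f (prod_encode ((y # xs) ! 0, (y # xs) ! 1)) = 0" for xs
    using assms(2) by simp
  from recursive.minim[OF *, OF this]
  show ?thesis by (simp add: computable_def)
qed

lemma computable_power [comp_intros]:
  assumes "computable f" "computable g"
  shows "computable (\<lambda>z. f z ^ g z)"
proof -
  have "computable (\<lambda>z. rec_nat 1 (\<lambda>k r. r * f z) (g z))"
    by (intro comp_intros assms computable_comp[OF assms(1)])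
  moreover have "rec_nat 1 (\<lambda>k r. r * x) n = x ^ n" for x n :: nat
    by (induction n) auto
  ultimately show ?thesis by simp
qed

lemma computable_div [comp_intros]:
  assumes "computable f" "computable g"
  shows "computable (\<lambda>z. f z div g z)"
proof -
  have "computable (\<lambda>z. LEAST q. g z = 0 \<or> f z < Suc q * g z)"
  proof (intro comp_intros)
    fix z show "\<exists>q. g z = 0 \<or> f z < Suc q * g z"
      by (cases "g z") (auto intro: exI[of _ "f z"])
  qed (intro computable_comp[OF assms(1)] computable_comp[OF assms(2)] comp_intros)+
  moreover have "(LEAST q. y = 0 \<or> x < Suc q * y) = x div y" for x y :: nat
  proof (cases "y = 0")
    case False
    show ?thesis
    proof (rule Least_equality)
      show "y = 0 \<or> x < Suc (x div y) * y"
        using False dividend_less_div_times[of y x] by simp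
      show "x div y \<le> q" if "y = 0 \<or> x < Suc q * y" for q
        using that False by (simp add: less_Suc_eq_le[symmetric] div_less_iff_less_mult del: mult_Suc)
    qed
  qed (auto intro: Least_equality)
  ultimately show ?thesis by simp
qed

lemma computable_mod [comp_intros]:
  "computable f \<Longrightarrow> computable g \<Longrightarrow> computable (\<lambda>z. f z mod g z)"
  unfolding minus_div_mult_eq_mod[symmetric] by (intro comp_intros)

text \<open>
  Enumerate all pairs \<open>(x, y)\<close> and output \<open>x\<close> when the pair satisfies \<open>P\<close>, and a fixed element of the
  set otherwise.  All c.e. sets below arise in this way.
\<close>

lemma ce_projection:
  assumes "decidable (\<lambda>e. P (pfst e) (psnd e))"
  shows "ce {x. \<exists>y. P x y}"
proof (cases "{x. \<exists>y. P x y} = {}")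
  case True then show ?thesis by (simp add: ce_def)
next
  case False
  then obtain x0 y0 where 0: "P x0 y0" by auto
  let ?f = "\<lambda>e. if P (pfst e) (psnd e) then pfst e else x0"
  have "computable ?f" by (intro comp_intros assms)
  moreover have "{x. \<exists>y. P x y} = range ?f"
  proof (intro set_eqI iffI)
    fix x assume "x \<in> {x. \<exists>y. P x y}"
    then obtain y where "P x y" by auto
    then have "x = ?f (prod_encode (x, y))" by simp
    then show "x \<in> range ?f" by blast
  qed (use 0 in \<open>auto split: if_splits\<close>)
  ultimately show ?thesis unfolding ce_def by blast
qed

lemma ce_enumeration: "ce A \<Longrightarrow> A \<noteq> {} \<Longrightarrow> \<exists>f. computable f \<and> range f = A"
  by (auto simp: ce_def)

section \<open>Initial segments and their codes\<close>

text \<open>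
  The string of the first \<open>L\<close> bits of \<open>X\<close> is represented by its length and by the number whose binary
  digits it lists, least significant digit first.  Cutting a string in two is then division with
  remainder by a power of two, and \<open>val_code\<close> turns the representation into the code of the string.
\<close>

definition initial_val :: "(nat \<Rightarrow> bool) \<Rightarrow> nat \<Rightarrow> nat" where
  "initial_val X L = (\<Sum>i<L. of_bool (X i) * 2 ^ i)"

definition val_code :: "nat \<Rightarrow> nat \<Rightarrow> nat" where
  "val_code L v = 2 ^ L - 1 + v"

definition initial :: "(nat \<Rightarrow> bool) \<Rightarrow> nat \<Rightarrow> bool list" where
  "initial X L = map X [0..<L]"

lemma length_initial [simp]: "length (initial X L) = L"
  by (simp add: initial_def)

lemma mem_cylinder_iff: "X \<in> cylinder \<sigma> \<longleftrightarrow> initial X (length \<sigma>) = \<sigma>"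
proof
  assume "X \<in> cylinder \<sigma>"
  then show "initial X (length \<sigma>) = \<sigma>"
    by (intro nth_equalityI) (auto simp: cylinder_def initial_def)
next
  assume "initial X (length \<sigma>) = \<sigma>"
  then have "\<sigma> ! i = X i" if "i < length \<sigma>" for i
    using that by (metis add_0 nth_map_upt diff_zero initial_def)
  then show "X \<in> cylinder \<sigma>" by (simp add: cylinder_def)
qed

lemma mem_open_of_iff: "X \<in> open_of U \<longleftrightarrow> (\<exists>j. initial X j \<in> U)"
  unfolding open_of_def UN_iff mem_cylinder_iff by (metis length_initial)

lemma initial_add: "initial X (i + j) = initial X i @ initial (tail i X) j"
  by (auto simp: initial_def tail_def list_eq_iff_nth_eq nth_append)

lemma prefix_initial_iff: "prefix (initial X i) (initial X j) \<longleftrightarrow> i \<le> j"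
proof
  assume "i \<le> j"
  then obtain d where "j = i + d" by (auto simp: le_iff_add)
  then show "prefix (initial X i) (initial X j)" by (simp add: initial_add)
next
  assume "prefix (initial X i) (initial X j)"
  then show "i \<le> j" using prefix_length_le by fastforce
qed

lemma prefix_free_initial_unique:
  assumes "prefix_free U" "initial X i \<in> U" "initial X j \<in> U"
  shows "i = j"
proof -
  have "initial X i = initial X j" 
    using assms prefix_initial_iff[of X i j] prefix_initial_iff[of X j i]
    unfolding prefix_free_def by (metis nle_le)
  then show ?thesis by (metis length_initial)
qed

lemma initial_Suc: "initial X (Suc L) = X 0 # initial (tail (Suc 0) X) L"
  by (auto simp: initial_def tail_def upt_conv_Cons map_Suc_upt[symmetric] simp del: upt_Suc)

lemma tail_add [simp]: "tail i (tail j X) = tail (j + i) X"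
  by (simp add: tail_def add.assoc)

lemma tail_0 [simp]: "tail 0 X = X"
  by (simp add: tail_def)

lemma initial_val_0 [simp]: "initial_val X 0 = 0"
  by (simp add: initial_val_def)

lemma initial_val_Suc: "initial_val X (Suc L) = of_bool (X 0) + 2 * initial_val (tail (Suc 0) X) L"
  unfolding initial_val_def tail_def by (subst sum.lessThan_Suc_shift) (simp add: sum_distrib_left mult_ac del: sum_mult_of_bool_eq sum_of_bool_mult_eq)

lemma initial_val_add: "initial_val X (i + j) = initial_val X i + 2 ^ i * initial_val (tail i X) j"
proof (induction i arbitrary: X)
  case (Suc i)
  show ?case using Suc[of "tail (Suc 0) X"] by (simp add: initial_val_Suc algebra_simps)
qed simp

lemma initial_val_less: "initial_val X L < 2 ^ L"
proof (induction L arbitrary: X)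
  case (Suc L)
  from Suc[of "tail (Suc 0) X"] show ?case by (auto simp: initial_val_Suc)
qed simp

lemma initial_val_mod: "j \<le> L \<Longrightarrow> initial_val X L mod 2 ^ j = initial_val X j"
  using initial_val_add[of X j "L - j"] initial_val_less[of X j] by simp

lemma initial_val_div: "j \<le> L \<Longrightarrow> initial_val X L div 2 ^ j = initial_val (tail j X) (L - j)"
  using initial_val_add[of X j "L - j"] initial_val_less[of X j] by simp

lemma str_code_initial: "str_code (initial X L) = val_code L (initial_val X L)"
proof (induction L arbitrary: X)
  case (Suc L)
  obtain q where "(2::nat) ^ L = Suc q" by (metis nat.exhaust power_not_zero zero_neq_numeral)
  then show ?case using Suc[of "tail (Suc 0) X"] by (simp add: initial_Suc initial_val_Suc val_code_def)
qed (simp add: initial_def val_code_def)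

lemma initial_exists: "\<exists>X. initial X (length \<sigma>) = \<sigma>"
  by (rule exI[of _ "\<lambda>i. \<sigma> ! i"]) (simp add: initial_def map_nth)

lemma initial_val_surj:
  assumes "v < 2 ^ L"
  shows "\<exists>X. initial_val X L = v"
  using assms
proof (induction L arbitrary: v)
  case (Suc L)
  then have "v div 2 < 2 ^ L" by auto
  with Suc.IH obtain X where "initial_val X L = v div 2" by blast
  then have "initial_val (case_nat (odd v) X) (Suc L) = v"
    by (simp add: initial_val_Suc tail_def)
  then show ?case by blast
qed auto

lemma str_code_inj: "str_code \<sigma> = str_code \<tau> \<longleftrightarrow> \<sigma> = \<tau>"
proof (induction \<sigma> arbitrary: \<tau>)
  case Nil then show ?case by (cases \<tau>) auto
next
  case (Cons b \<sigma>)
  show ?case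
  proof (cases \<tau>)
    case (Cons c \<rho>)
    have "str_code (b # \<sigma>) = str_code (c # \<rho>) \<longleftrightarrow> b = c \<and> str_code \<sigma> = str_code \<rho>"
      by (auto split: if_splits) presburger+
    then show ?thesis using Cons Cons.IH by simp
  qed auto
qed

lemma length_le_str_code: "length \<sigma> \<le> str_code \<sigma>"
  by (induction \<sigma>) auto

section \<open>The uniform measure\<close>

interpretation coin: sequence_space "measure_pmf (bernoulli_pmf (1 / 2))"
  by unfold_locales

interpretation cantor: prob_space cantor
  unfolding cantor_def by (rule coin.P.prob_space_axioms)

lemma space_cantor [simp]: "space cantor = UNIV"
  by (simp add: cantor_def space_PiM)

lemma measurable_coordinate [measurable]: "(\<lambda>X. X i) \<in> measurable cantor (count_space UNIV)"
  unfolding cantor_def by (rule measurable_compose[OF measurable_component_singleton[of i]]) auto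

lemma measurable_initial_val [measurable]: "(\<lambda>X. initial_val X L) \<in> measurable cantor (count_space UNIV)"
  unfolding initial_val_def by measurable

lemma sets_initial_val [measurable]: "{X. Q (initial_val X L)} \<in> sets cantor"
proof -
  have "{X \<in> space cantor. Q (initial_val X L)} \<in> sets cantor" by measurable
  then show ?thesis by simp
qed

lemma measurable_cantorI:
  assumes "\<And>i. (\<lambda>x. f x i) \<in> measurable M (count_space UNIV)"
  shows "f \<in> measurable M cantor"
  unfolding cantor_def
proof (rule measurable_PiM_single')
  show "(\<lambda>x. f x i) \<in> measurable M (measure_pmf (bernoulli_pmf (1 / 2)))" for i
    using assms[of i] by (simp cong: measurable_cong_sets)
qed auto

lemma measurable_tail [measurable]: "tail k \<in> measurable cantor cantor"
  by (rule measurable_cantorI) (simp add: tail_def)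

lemma measurable_cons [measurable]: "case_nat b \<in> measurable cantor cantor"
proof (rule measurable_cantorI)
  show "(\<lambda>X. case_nat b X i) \<in> measurable cantor (count_space UNIV)" for i
    by (cases i) auto
qed

lemma sets_cons: "A \<in> sets cantor \<Longrightarrow> {Y. case_nat b Y \<in> A} \<in> sets cantor"
  using measurable_sets[OF measurable_cons, of A b] by (simp add: vimage_def)

lemma sets_tail: "A \<in> sets cantor \<Longrightarrow> {Y. tail k Y \<in> A} \<in> sets cantor"
  using measurable_sets[OF measurable_tail, of A k] by (simp add: vimage_def)

text \<open>
  Conditioning on the first bit.  The other facts about the measure are derived from this one by
  induction on the number of bits.
\<close>

lemma measure_split:
  assumes A: "A \<in> sets cantor"
  shows "measure cantor A =
    (measure cantor {Y. case_nat False Y \<in> A} + measure cantor {Y. case_nat True Y \<in> A}) / 2"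
proof -
  let ?M = "measure_pmf (bernoulli_pmf (1 / 2))"
  have m: "(\<lambda>(s, \<omega>). case_nat s \<omega>) \<in> measurable (?M \<Otimes>\<^sub>M cantor) cantor"
  proof (rule measurable_cantorI)
    show "(\<lambda>x. (case x of (s, \<omega>) \<Rightarrow> case_nat s \<omega>) i) \<in> measurable (?M \<Otimes>\<^sub>M cantor) (count_space UNIV)" for i
    proof (cases i)
      case 0
      have "fst \<in> measurable (?M \<Otimes>\<^sub>M cantor) ?M" by measurable
      then show ?thesis using 0 by (simp add: split_beta' cong: measurable_cong_sets)
    qed (simp add: split_beta')
  qed
  have "emeasure cantor A = emeasure (distr (?M \<Otimes>\<^sub>M cantor) cantor (\<lambda>(s, \<omega>). case_nat s \<omega>)) A"
    using coin.PiM_iter by (simp add: cantor_def)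
  also have "\<dots> = emeasure (?M \<Otimes>\<^sub>M cantor) ((\<lambda>(s, \<omega>). case_nat s \<omega>) -` A \<inter> space (?M \<Otimes>\<^sub>M cantor))"
    by (rule emeasure_distr[OF m A])
  also have "\<dots> = (\<integral>\<^sup>+s. emeasure cantor {Y. case_nat s Y \<in> A} \<partial>?M)"
    by (subst cantor.emeasure_pair_measure_alt[OF measurable_sets[OF m A]])
       (simp add: vimage_def space_pair_measure)
  also have "\<dots> = ennreal ((measure cantor {Y. case_nat False Y \<in> A} + measure cantor {Y. case_nat True Y \<in> A}) / 2)"
    by (simp add: nn_integral_bernoulli_pmf cantor.emeasure_eq_measure ennreal_mult'[symmetric]
       ennreal_plus[symmetric] del: ennreal_plus ennreal_half)
  finally show ?thesis
    by (simp add: cantor.emeasure_eq_measure)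
qed

text \<open>
  A clopen set that depends on the first \<open>L\<close> bits only is measured by counting strings, which a
  computable function can do.
\<close>

lemma measure_initial_val:
  "measure cantor {X. Q (initial_val X L)} = real (card {v. v < 2 ^ L \<and> Q v}) / 2 ^ L"
proof (induction L arbitrary: Q)
  case 0
  show ?case
  proof (cases "Q 0")
    case True
    then have "{v. v = 0 \<and> Q v} = {0}" by auto
    then show ?thesis using True cantor.prob_space by simp
  next
    case False
    then have "{v. v = 0 \<and> Q v} = {}" by auto
    then show ?thesis using False by (simp only: initial_val_0) simp
  qed
next
  case (Suc L)
  have t: "tail (Suc 0) (case_nat b Y) = Y" for b and Y :: "nat \<Rightarrow> bool"
    by (simp add: tail_def)
  let ?F = "{v. v < 2 ^ L \<and> Q (2 * v)}" and ?T = "{v. v < 2 ^ L \<and> Q (Suc (2 * v))}"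
  have eq: "{v. v < 2 ^ Suc L \<and> Q v} = (\<lambda>v. 2 * v) ` ?F \<union> (\<lambda>v. Suc (2 * v)) ` ?T"
  proof (intro set_eqI iffI)
    fix v assume v: "v \<in> {v. v < 2 ^ Suc L \<and> Q v}"
    show "v \<in> (\<lambda>v. 2 * v) ` ?F \<union> (\<lambda>v. Suc (2 * v)) ` ?T"
    proof (cases "even v")
      case True then show ?thesis using v by (auto elim!: evenE)
    next
      case False then show ?thesis using v by (auto elim!: oddE)
    qed
  qed auto
  have "card {v. v < 2 ^ Suc L \<and> Q v} = card ?F + card ?T"
    unfolding eq
    by (subst card_Un_disjoint) (auto simp: card_image inj_on_def, presburger)
  then show ?case
    by (subst measure_split[OF sets_initial_val])
       (simp add: initial_val_Suc t Suc.IH[of "\<lambda>v. Q (2 * v)"] Suc.IH[of "\<lambda>v. Q (Suc (2 * v))"] add_divide_distrib)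
qed

lemma sets_cylinder [measurable]: "cylinder \<sigma> \<in> sets cantor"
proof -
  have "cylinder \<sigma> = {X. val_code (length \<sigma>) (initial_val X (length \<sigma>)) = str_code \<sigma>}"
    by (auto simp: mem_cylinder_iff str_code_initial[symmetric] str_code_inj)
  then show ?thesis using sets_initial_val[of "\<lambda>v. val_code (length \<sigma>) v = str_code \<sigma>"] by simp
qed

lemma sets_open_of [measurable]: "open_of U \<in> sets cantor"
  unfolding open_of_def by (rule sets.countable_UN') auto

lemma tail_image_1: "tail (Suc 0) ` A = {Y. case_nat False Y \<in> A} \<union> {Y. case_nat True Y \<in> A}"
proof (intro set_eqI iffI)
  fix Y assume "Y \<in> tail (Suc 0) ` A"
  then obtain Z where Z: "Z \<in> A" "Y = tail (Suc 0) Z" by auto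
  then have "Z = case_nat (Z 0) Y" by (auto simp: fun_eq_iff tail_def split: nat.split)
  then show "Y \<in> {Y. case_nat False Y \<in> A} \<union> {Y. case_nat True Y \<in> A}"
    using Z by (cases "Z 0") auto
next
  fix Y assume "Y \<in> {Y. case_nat False Y \<in> A} \<union> {Y. case_nat True Y \<in> A}"
  moreover have "Y = tail (Suc 0) (case_nat b Y)" for b by (simp add: tail_def)
  ultimately show "Y \<in> tail (Suc 0) ` A" by blast
qed

text \<open>
  Deleting the first bit maps the halves of \<open>A\<close> in the two cylinders of length one onto their
  rescaled copies, each at twice its measure; hence the image has at most twice the measure of \<open>A\<close>.
\<close>

lemma tail_image:
  assumes A: "A \<in> sets cantor"
  shows "tail k ` A \<in> sets cantor \<and> measure cantor (tail k ` A) \<le> 2 ^ k * measure cantor A"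
proof (induction k)
  case 0 then show ?case using A by (simp add: tail_def)
next
  case (Suc k)
  let ?B = "tail k ` A"
  have eq: "tail (Suc k) ` A = tail (Suc 0) ` ?B" by (simp add: image_image)
  have "measure cantor (tail (Suc 0) ` ?B) \<le> 2 * measure cantor ?B"
    unfolding tail_image_1
    using measure_Un_le[of "{Y. case_nat False Y \<in> ?B}" cantor "{Y. case_nat True Y \<in> ?B}"]
      Suc measure_split[of ?B] sets_cons[of ?B] by simp
  then show ?case using Suc sets_cons unfolding eq tail_image_1 by auto
qed

lemma measure_cylinder_tail:
  assumes A: "A \<in> sets cantor"
  shows "measure cantor {X \<in> cylinder \<sigma>. tail (length \<sigma>) X \<in> A} = (1 / 2) ^ length \<sigma> * measure cantor A"
proof (induction \<sigma>)
  case Nil then show ?case by (simp add: cylinder_def)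
next
  case (Cons b \<sigma>)
  let ?S = "{X \<in> cylinder \<sigma>. tail (length \<sigma>) X \<in> A}"
  let ?B = "{X \<in> cylinder (b # \<sigma>). tail (length (b # \<sigma>)) X \<in> A}"
  have B: "?B \<in> sets cantor"
    using sets.Int[OF sets_cylinder sets_tail[OF A]] by (simp add: Collect_conj_eq)
  have t: "tail (Suc k) (case_nat c Y) = tail k Y" for c k and Y :: "nat \<Rightarrow> bool"
    by (simp add: tail_def)
  have "{Y. case_nat c Y \<in> ?B} = (if c = b then ?S else {})" for c
    by (auto simp: mem_cylinder_iff initial_Suc t tail_def)
  then show ?case using measure_split[OF B] Cons by (cases b) auto
qed

lemma measure_cylinder: "measure cantor (cylinder \<sigma>) = (1 / 2) ^ length \<sigma>"
  using measure_cylinder_tail[of UNIV \<sigma>] cantor.prob_space sets.top[of cantor] by simp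

lemma sets_prefix_tail [measurable]:
  assumes "A \<in> sets cantor"
  shows "{X. \<exists>j. initial X j \<in> U \<and> tail j X \<in> A} \<in> sets cantor"
proof -
  have "{X. \<exists>j. initial X j \<in> U \<and> tail j X \<in> A} = (\<Union>\<sigma>\<in>U. {X \<in> cylinder \<sigma>. tail (length \<sigma>) X \<in> A})"
    by (auto simp: mem_cylinder_iff) (metis length_initial)
  moreover have "\<dots> \<in> sets cantor"
    using sets.Int[OF sets_cylinder sets_tail[OF assms]]
    by (intro sets.countable_UN') (auto simp: Collect_conj_eq)
  ultimately show ?thesis by simp
qed

text \<open>
  The sequences that start with a string of \<open>U\<close> and continue in \<open>A\<close> form a disjoint union of copies
  of \<open>A\<close>, scaled by the measures of the cylinders of \<open>U\<close>.
\<close>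

lemma measure_prefix_tail:
  assumes A: "A \<in> sets cantor" and U: "prefix_free U"
  shows "measure cantor {X. \<exists>j. initial X j \<in> U \<and> tail j X \<in> A} =
    measure cantor (open_of U) * measure cantor A"
proof -
  have *: "emeasure cantor {X. \<exists>j. initial X j \<in> U \<and> tail j X \<in> A} =
      (\<integral>\<^sup>+\<sigma>. ennreal ((1 / 2) ^ length \<sigma>) \<partial>count_space U) * emeasure cantor A" 
    if A: "A \<in> sets cantor" for A
  proof -
    let ?F = "\<lambda>\<sigma>. {X \<in> cylinder \<sigma>. tail (length \<sigma>) X \<in> A}"
    have "{X. \<exists>j. initial X j \<in> U \<and> tail j X \<in> A} = (\<Union>\<sigma>\<in>U. ?F \<sigma>)"
      by (auto simp: mem_cylinder_iff) (metis length_initial)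
    moreover have "emeasure cantor (\<Union>\<sigma>\<in>U. ?F \<sigma>) = (\<integral>\<^sup>+\<sigma>. emeasure cantor (?F \<sigma>) \<partial>count_space U)"
    proof (rule emeasure_UN_countable)
      show "?F \<sigma> \<in> sets cantor" for \<sigma>
        using sets.Int[OF sets_cylinder sets_tail[OF A]] by (simp add: Collect_conj_eq)
      have "\<sigma> = \<tau>" if "\<sigma> \<in> U" "\<tau> \<in> U" "initial X (length \<sigma>) = \<sigma>" "initial X (length \<tau>) = \<tau>" for X \<sigma> \<tau>
        using prefix_free_initial_unique[OF U, of X "length \<sigma>" "length \<tau>"] that by metis
      then show "disjoint_family_on ?F U"
        unfolding disjoint_family_on_def mem_cylinder_iff by blast
    qed auto
    moreover have "emeasure cantor (?F \<sigma>) = ennreal ((1 / 2) ^ length \<sigma>) * emeasure cantor A" for \<sigma>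
      by (simp add: cantor.emeasure_eq_measure measure_cylinder_tail[OF A] ennreal_mult)
    ultimately show ?thesis by (simp add: nn_integral_multc)
  qed
  have "open_of U = {X. \<exists>j. initial X j \<in> U \<and> tail j X \<in> UNIV}"
    by (auto simp: mem_open_of_iff)
  then have "emeasure cantor (open_of U) = (\<integral>\<^sup>+\<sigma>. ennreal ((1 / 2) ^ length \<sigma>) \<partial>count_space U)"
    using *[of UNIV] cantor.emeasure_space_1 sets.top[of cantor] by simp
  then have "emeasure cantor {X. \<exists>j. initial X j \<in> U \<and> tail j X \<in> A} = emeasure cantor (open_of U) * emeasure cantor A"
    using *[OF A] by simp
  then show ?thesis
    by (simp add: cantor.emeasure_eq_measure ennreal_mult[symmetric])
qed

section \<open>Open sets presented by clopen stages\<close>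

abbreviation computable2 :: "(nat \<Rightarrow> nat \<Rightarrow> nat) \<Rightarrow> bool" where
  "computable2 f \<equiv> computable (\<lambda>e. f (pfst e) (psnd e))"

abbreviation decidable3 :: "(nat \<Rightarrow> nat \<Rightarrow> nat \<Rightarrow> bool) \<Rightarrow> bool" where
  "decidable3 P \<equiv> decidable (\<lambda>e. P (pfst e) (pfst (psnd e)) (psnd (psnd e)))"

lemma decidable_comp: "decidable P \<Longrightarrow> computable g \<Longrightarrow> decidable (\<lambda>z. P (g z))"
  unfolding decidable_def by (rule computable_comp)

lemma computable2_comp:
  assumes "computable2 f" "computable g" "computable h"
  shows "computable (\<lambda>z. f (g z) (h z))"
  using computable_comp[OF assms(1) computable_pair[OF assms(2,3)]] by simp

lemma decidable3_comp:
  assumes "decidable3 P" "computable f" "computable g" "computable h"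
  shows "decidable (\<lambda>z. P (f z) (g z) (h z))"
  using decidable_comp[OF assms(1) computable_pair[OF assms(2) computable_pair[OF assms(3,4)]]] by simp

lemma computable_val_code [comp_intros]:
  "computable f \<Longrightarrow> computable g \<Longrightarrow> computable (\<lambda>z. val_code (f z) (g z))"
  unfolding val_code_def by (intro comp_intros)

lemma val_code_str_code: "v < 2 ^ L \<Longrightarrow> \<exists>\<sigma>. val_code L v = str_code \<sigma>"
  using initial_val_surj str_code_initial by metis

lemma str_code_initial_eq_val_code:
  assumes "v < 2 ^ L"
  shows "str_code (initial X j) = val_code L v \<longleftrightarrow> j = L \<and> v = initial_val X j"
proof
  assume eq: "str_code (initial X j) = val_code L v"
  obtain Y where Y: "v = initial_val Y L" using initial_val_surj[OF assms] by metis
  then have "initial X j = initial Y L" using eq by (simp add: str_code_initial[symmetric] str_code_inj)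
  then have "j = L" by (metis length_initial)
  moreover from this have "val_code L (initial_val X L) = val_code L v" using eq by (simp add: str_code_initial)
  ultimately show "j = L \<and> v = initial_val X j" unfolding val_code_def add_left_cancel by simp
qed (simp add: str_code_initial)

lemma card_eq_sum: "card {v::nat. v < N \<and> Q v} = (\<Sum>v<N. of_bool (Q v))"
  by (simp add: Collect_conj_eq Int_commute lessThan_def)

lemma measure_initial_val_sum:
  "measure cantor {X. Q (initial_val X L)} = real (\<Sum>v<2 ^ L. of_bool (Q v)) / 2 ^ L"
  unfolding measure_initial_val card_eq_sum by simp

text \<open>
  An open set that is presented as a union of uniformly decidable clopen sets, where stage \<open>s\<close> reads
  exactly \<open>l n s\<close> bits, has a c.e. prefix-free set of generators: take at stage \<open>s\<close> the accepted
  strings of length \<open>l n s\<close> that no earlier stage has accepted through a prefix.  A proper prefix of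
  such a string cannot be a generator too, since it would belong to an earlier stage.  All open sets
  constructed below are presented in this way.
\<close>

lemma uniformly_ce_open_stages:
  assumes C: "decidable3 C" and l: "computable2 l" and mono: "\<And>n. strict_mono (l n)"
  shows "uniformly_ce_open (\<lambda>n. {X. \<exists>s. C n s (initial_val X (l n s))})"
proof -
  define fresh where "fresh n s v \<longleftrightarrow> v < 2 ^ l n s \<and> C n s v \<and> (\<forall>r<s. \<not> C n r (v mod 2 ^ l n r))" for n s v
  define U where "U n = {\<sigma>. \<exists>s v. str_code \<sigma> = val_code (l n s) v \<and> fresh n s v}" for n
  have fresh_initial_val: "fresh n s (initial_val X (l n s)) \<longleftrightarrow>
      C n s (initial_val X (l n s)) \<and> (\<forall>r<s. \<not> C n r (initial_val X (l n r)))" for n s X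
  proof -
    have "initial_val X (l n s) mod 2 ^ l n r = initial_val X (l n r)" if "r < s" for r
      using that mono[of n] by (intro initial_val_mod) (simp add: strict_mono_less less_imp_le)
    then show ?thesis by (auto simp: fresh_def initial_val_less)
  qed
  have initial_U: "initial X j \<in> U n \<longleftrightarrow> (\<exists>s. j = l n s \<and> fresh n s (initial_val X j))" for X j n
  proof -
    have "initial X j \<in> U n \<longleftrightarrow> (\<exists>s v. str_code (initial X j) = val_code (l n s) v \<and> fresh n s v)"
      by (simp add: U_def)
    also have "\<dots> \<longleftrightarrow> (\<exists>s v. (j = l n s \<and> v = initial_val X j) \<and> fresh n s v)"
      by (metis fresh_def str_code_initial_eq_val_code)
    finally show ?thesis by blast
  qed
  have "prefix_free (U n)" for n
    unfolding prefix_free_def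
  proof (intro ballI impI)
    fix \<sigma> \<tau> assume \<sigma>: "\<sigma> \<in> U n" and \<tau>: "\<tau> \<in> U n" and p: "prefix \<sigma> \<tau>"
    obtain X where X: "initial X (length \<tau>) = \<tau>" using initial_exists by blast
    from p obtain \<rho> where \<rho>: "\<tau> = \<sigma> @ \<rho>" by (auto simp: prefix_def)
    have X': "initial X (length \<sigma>) = \<sigma>"
      using X initial_add[of X "length \<sigma>" "length \<rho>"] \<rho> by simp
    obtain s r where "length \<sigma> = l n s" "length \<tau> = l n r"
      "fresh n s (initial_val X (l n s))" "fresh n r (initial_val X (l n r))"
      using \<sigma> \<tau> X X' initial_U[of X "length \<sigma>"] initial_U[of X "length \<tau>"] by metis
    moreover from this have "s = r"
      unfolding fresh_initial_val by (metis linorder_neqE_nat)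
    ultimately show "\<sigma> = \<tau>" using X X' by metis
  qed
  moreover have "{X. \<exists>s. C n s (initial_val X (l n s))} = open_of (U n)" for n
  proof -
    have "(\<exists>s. C n s (initial_val X (l n s))) \<longleftrightarrow> (\<exists>s. fresh n s (initial_val X (l n s)))" for X
      unfolding fresh_initial_val using exists_least_iff[of "\<lambda>s. C n s (initial_val X (l n s))"] by blast
    then show ?thesis by (auto simp: mem_open_of_iff initial_U)
  qed
  moreover have "ce {prod_encode (n, str_code \<sigma>) |n \<sigma>. \<sigma> \<in> U n}"
  proof -
    have "decidable (\<lambda>e. psnd (pfst e) = val_code (l (pfst (pfst e)) (pfst (psnd e))) (psnd (psnd e)) \<and>
        fresh (pfst (pfst e)) (pfst (psnd e)) (psnd (psnd e)))"
      unfolding fresh_def by (intro comp_intros computable2_comp[OF l] decidable3_comp[OF C])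
    note ce_projection[OF this]
    moreover have "{prod_encode (n, str_code \<sigma>) |n \<sigma>. \<sigma> \<in> U n} = {x. \<exists>y. psnd x = val_code (l (pfst x) (pfst y)) (psnd y) \<and>
        fresh (pfst x) (pfst y) (psnd y)}" (is "?A = ?B")
    proof (intro set_eqI iffI)
      fix x assume "x \<in> ?A"
      then obtain n \<sigma> s v where x: "x = prod_encode (n, str_code \<sigma>)"
        "str_code \<sigma> = val_code (l n s) v" "fresh n s v" by (auto simp: U_def)
      then show "x \<in> ?B" by (auto intro!: exI[of _ "prod_encode (s, v)"])
    next
      fix x assume "x \<in> ?B"
      then obtain y where y: "psnd x = val_code (l (pfst x) (pfst y)) (psnd y)" 
        "fresh (pfst x) (pfst y) (psnd y)" by auto
      then obtain \<sigma> where "psnd x = str_code \<sigma>" using val_code_str_code fresh_def by metis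
      moreover from this have "\<sigma> \<in> U (pfst x)" using y unfolding U_def by force
      ultimately show "x \<in> ?A" by (metis (mono_tags, lifting) mem_Collect_eq pair_pfst_psnd)
    qed
    ultimately show ?thesis by simp
  qed
  ultimately show ?thesis unfolding uniformly_ce_open_def by blast
qed

lemma ce_open_section:
  assumes "uniformly_ce_open \<U>"
  shows "ce_open (\<U> n)"
proof -
  obtain U where U: "ce {prod_encode (n, str_code \<sigma>) |n \<sigma>. \<sigma> \<in> U n}"
    "prefix_free (U n)" "\<U> n = open_of (U n)"
    using assms by (auto simp: uniformly_ce_open_def)
  have "ce (str_code ` U n)"
  proof (cases "{prod_encode (n, str_code \<sigma>) |n \<sigma>. \<sigma> \<in> U n} = {}")
    case True
    then have "U n = {}" by auto
    then show ?thesis by (simp add: ce_def)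
  next
    case False
    then obtain f where f: "computable f" "{prod_encode (n, str_code \<sigma>) |n \<sigma>. \<sigma> \<in> U n} = range f"
      using U(1) by (auto simp: ce_def)
    have "decidable (\<lambda>e. f (psnd e) = prod_encode (n, pfst e))"
      by (intro comp_intros computable_comp[OF f(1)])
    note ce_projection[OF this]
    moreover have "str_code ` U n = {x. \<exists>y. f y = prod_encode (n, x)}"
    proof -
      have "(\<exists>y. f y = prod_encode (n, x)) \<longleftrightarrow> prod_encode (n, x) \<in> range f" for x
        by (metis rangeE rangeI)
      then show ?thesis unfolding f(2)[symmetric] by auto
    qed
    ultimately show ?thesis by simp
  qed
  then show ?thesis using U by (auto simp: ce_open_def ce_strings_def)
qed

text \<open>
  For \<open>E\<close> enumerating the codes of the pairs \<open>(n, \<sigma>)\<close> with \<open>\<sigma> \<in> U n\<close>, \<open>stage E n t\<close> is the finite part of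
  \<open>U n\<close> found after \<open>t\<close> steps.  The sum \<open>length_bound E t\<close> of the enumerated codes is a crude bound on
  the lengths of the strings in it, so that membership in the clopen set \<open>open_of (stage E n t)\<close> is
  decided by that many bits.
\<close>

definition stage :: "(nat \<Rightarrow> nat) \<Rightarrow> nat \<Rightarrow> nat \<Rightarrow> bool list set" where
  "stage E n t = {\<sigma>. \<exists>i<t. E i = prod_encode (n, str_code \<sigma>)}"

definition length_bound :: "(nat \<Rightarrow> nat) \<Rightarrow> nat \<Rightarrow> nat" where
  "length_bound E t = (\<Sum>i<t. E i)"

definition stage_covers :: "(nat \<Rightarrow> nat) \<Rightarrow> nat \<Rightarrow> nat \<Rightarrow> nat \<Rightarrow> nat \<Rightarrow> bool" where
  "stage_covers E n t L v \<longleftrightarrow> (\<exists>j\<le>L. \<exists>i<t. E i = prod_encode (n, val_code j (v mod 2 ^ j)))"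

lemma computable_length_bound:
  assumes "computable E" "computable t"
  shows "computable (\<lambda>z. length_bound E (t z))"
  unfolding length_bound_def by (intro comp_intros assms computable_comp[OF assms(1)])

lemma decidable_stage_covers:
  assumes "computable E" "computable n" "computable t" "computable L" "computable v"
  shows "decidable (\<lambda>z. stage_covers E (n z) (t z) (L z) (v z))"
  unfolding stage_covers_def
  by (intro comp_intros assms assms[THEN computable_comp])

lemma length_le_length_bound:
  assumes "\<sigma> \<in> stage E n t"
  shows "length \<sigma> \<le> length_bound E t"
proof -
  from assms obtain i where i: "i < t" "E i = prod_encode (n, str_code \<sigma>)" by (auto simp: stage_def)
  have "length \<sigma> \<le> prod_encode (n, str_code \<sigma>)"
    using length_le_str_code le_prod_encode_2 le_trans by blast
  also have "\<dots> \<le> (\<Sum>i<t. E i)" using i member_le_sum[of i "{..<t}" E] by auto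
  finally show ?thesis by (simp add: length_bound_def)
qed

lemma stage_covers_iff:
  assumes "length_bound E t \<le> L"
  shows "stage_covers E n t L (initial_val X L) \<longleftrightarrow> X \<in> open_of (stage E n t)"
proof -
  have "stage_covers E n t L (initial_val X L) \<longleftrightarrow> (\<exists>j\<le>L. initial X j \<in> stage E n t)"
    unfolding stage_covers_def stage_def by (simp add: str_code_initial initial_val_mod cong: conj_cong)
  also have "\<dots> \<longleftrightarrow> X \<in> open_of (stage E n t)"
    unfolding mem_open_of_iff using length_le_length_bound assms by (metis le_trans length_initial)
  finally show ?thesis .
qed

lemma measure_stage:
  assumes "length_bound E t \<le> L"
  shows "measure cantor (open_of (stage E n t)) = real (\<Sum>v<2 ^ L. of_bool (stage_covers E n t L v)) / 2 ^ L"
  using measure_initial_val_sum[of "stage_covers E n t L" L] stage_covers_iff[OF assms] by simp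

lemma stage_mono: "t \<le> t' \<Longrightarrow> stage E n t \<subseteq> stage E n t'"
  by (force simp: stage_def)

lemma open_of_mono: "U \<subseteq> V \<Longrightarrow> open_of U \<subseteq> open_of V"
  by (auto simp: open_of_def)

lemma stage_union:
  assumes "range E = {prod_encode (n, str_code \<sigma>) |n \<sigma>. \<sigma> \<in> U n}"
  shows "(\<Union>t. stage E n t) = U n"
proof (intro set_eqI iffI)
  fix \<sigma> assume "\<sigma> \<in> (\<Union>t. stage E n t)"
  then have "prod_encode (n, str_code \<sigma>) \<in> range E" by (auto simp: stage_def) (metis rangeI)
  then show "\<sigma> \<in> U n" unfolding assms by (auto simp: str_code_inj)
next
  fix \<sigma> assume "\<sigma> \<in> U n"
  then have "prod_encode (n, str_code \<sigma>) \<in> range E" unfolding assms by auto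
  then show "\<sigma> \<in> (\<Union>t. stage E n t)" by (auto simp: stage_def image_iff) (metis lessI)
qed

lemma open_of_UN: "open_of (\<Union>t. S t) = (\<Union>t. open_of (S t))"
  by (auto simp: open_of_def)

text \<open>
  If the measures are uniformly computable, then one can compute how long to enumerate until at most
  \<open>(1 / 2) ^ m\<close> is missing: wait until the measure of the finite part, a dyadic rational found by
  counting, comes close to the approximation of the limit.  This is where computability of the
  measure, and not only enumerability of the set, is used.
\<close>

lemma modulus_exists:
  assumes E: "computable E" and range: "range E = {prod_encode (n, str_code \<sigma>) |n \<sigma>. \<sigma> \<in> U n}"
    and abc: "computable2 a" "computable2 b" "computable2 c"
    and approx: "\<And>n m. \<bar>measure cantor (open_of (U n)) -
      (real (a n m) - real (b n m)) / (real (c n m) + 1)\<bar> \<le> (1 / 2) ^ m"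
  obtains T where "computable2 T" "\<And>n m. m \<le> T n m"
    "\<And>n m. measure cantor (open_of (U n)) \<le> measure cantor (open_of (stage E n (T n m))) + (1 / 2) ^ m"
proof -
  define cnt where "cnt n t = (\<Sum>v<2 ^ length_bound E t. of_bool (stage_covers E n t (length_bound E t) v) :: nat)" for n t
  \<comment> \<open>A comparison of rationals with the denominators cleared, see \<open>good_iff\<close> below.\<close>
  define good where "good n m t \<longleftrightarrow> a n m * (2 ^ length_bound E t * 2 ^ m) \<le>
     (cnt n t * 2 ^ m + 2 * 2 ^ length_bound E t) * Suc (c n m) + b n m * (2 ^ length_bound E t * 2 ^ m)" for n m t
  let ?\<mu> = "\<lambda>n. measure cantor (open_of (U n))"
  let ?\<nu> = "\<lambda>n t. measure cantor (open_of (stage E n t))"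
  have nu: "?\<nu> n t = real (cnt n t) / 2 ^ length_bound E t" for n t
    using measure_stage[of E t "length_bound E t" n] by (simp add: cnt_def)
  have good_iff: "good n m t \<longleftrightarrow> 
      (real (a n m) - real (b n m)) / (real (c n m) + 1) \<le> ?\<nu> n t + 2 * (1 / 2) ^ m" for n m t
  proof -
    define P where "P = (2::real) ^ length_bound E t"
    define Q where "Q = (2::real) ^ m"
    have pos: "P > 0" "Q > 0" by (auto simp: P_def Q_def)
    have cross: "x / C \<le> N / D \<longleftrightarrow> x * D \<le> N * C" if "C > 0" "D > 0" for x C N D :: real
      using that by (simp add: field_simps)
    have "good n m t \<longleftrightarrow> real (a n m * (2 ^ length_bound E t * 2 ^ m)) \<le>
      real ((cnt n t * 2 ^ m + 2 * 2 ^ length_bound E t) * Suc (c n m) + b n m * (2 ^ length_bound E t * 2 ^ m))"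
      unfolding good_def by (simp only: of_nat_le_iff)
    also have "\<dots> \<longleftrightarrow> real (a n m) * (P * Q) \<le>
      (real (cnt n t) * Q + 2 * P) * (real (c n m) + 1) + real (b n m) * (P * Q)"
      by (simp only: P_def Q_def of_nat_mult of_nat_add of_nat_power of_nat_numeral of_nat_Suc add.commute[of 1])
    also have "\<dots> \<longleftrightarrow> (real (a n m) - real (b n m)) * (P * Q) \<le>
      (real (cnt n t) * Q + 2 * P) * (real (c n m) + 1)"
      unfolding left_diff_distrib by linarith
    also have "\<dots> \<longleftrightarrow> (real (a n m) - real (b n m)) / (real (c n m) + 1) \<le>
      (real (cnt n t) * Q + 2 * P) / (P * Q)"
      by (rule cross[symmetric]) (use pos in auto)
    also have "(real (cnt n t) * Q + 2 * P) / (P * Q) = real (cnt n t) / P + 2 / Q"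
      using pos by (simp add: add_divide_distrib)
    also have "2 / Q = 2 * (1 / 2) ^ m" by (simp add: Q_def power_divide)
    finally show ?thesis unfolding nu P_def .
  qed
  have ex: "\<exists>t. good n m t" for n m
  proof -
    have "(\<lambda>t. ?\<nu> n t) \<longlonglongrightarrow> measure cantor (\<Union>t. open_of (stage E n t))"
      by (rule cantor.finite_Lim_measure_incseq)
        (auto intro!: incseq_SucI open_of_mono stage_mono)
    then have "(\<lambda>t. ?\<nu> n t) \<longlonglongrightarrow> ?\<mu> n"
      by (simp add: open_of_UN[symmetric] stage_union[OF range])
    then have "eventually (\<lambda>t. ?\<nu> n t > ?\<mu> n - (1 / 2) ^ m) sequentially"
      by (rule order_tendstoD) simp
    then obtain t where "?\<nu> n t > ?\<mu> n - (1 / 2) ^ m" by (auto simp: eventually_sequentially)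
    then have "good n m t" using approx[of n m] unfolding good_iff by linarith
    then show ?thesis ..
  qed
  \<comment> \<open>Precision \<open>m + 2\<close> absorbs the three errors in \<open>good\<close> and \<open>approx\<close>; the summand \<open>m\<close> makes the stages exhaust \<open>U n\<close>.\<close>
  define T where "T n m = m + (LEAST t. good n (m + 2) t)" for n m
  have "computable2 T"
    unfolding T_def good_def cnt_def
    by (intro comp_intros decidable_stage_covers computable_length_bound E abc[THEN computable2_comp])
      (rule ex[unfolded good_def cnt_def])
  moreover have "?\<mu> n \<le> ?\<nu> n (T n m) + (1 / 2) ^ m" for n m
  proof -
    define t where "t = (LEAST t. good n (m + 2) t)"
    have "good n (m + 2) t" unfolding t_def by (rule LeastI_ex) (rule ex)
    moreover have "(1 / 2 :: real) ^ (m + 2) = (1 / 2) ^ m / 4" by simp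
    ultimately have "?\<mu> n \<le> ?\<nu> n t + (1 / 2) ^ m"
      using approx[of n "m + 2"] zero_le_power[of "1 / 2 :: real" m] unfolding good_iff by linarith
    also have "?\<nu> n t \<le> ?\<nu> n (T n m)"
      by (intro cantor.finite_measure_mono open_of_mono stage_mono sets_open_of) (simp add: T_def t_def)
    finally show ?thesis by simp
  qed
  moreover have "m \<le> T n m" for n m by (simp add: T_def)
  ultimately show ?thesis by (intro that)
qed

lemma computable_real_stages:
  assumes C: "decidable (\<lambda>e. C (pfst e) (psnd e))" and l: "computable l"
    and approx: "\<And>s. \<bar>x - measure cantor {X. C s (initial_val X (l s))}\<bar> \<le> (1 / 2) ^ s"
  shows "computable_real x"
proof -
  let ?a = "\<lambda>s. \<Sum>v<2 ^ l s. of_bool (C s v) :: nat"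
  have "computable ?a"
    by (intro comp_intros l decidable_comp[OF C, of "\<lambda>e. prod_encode (psnd e, pfst e)", simplified])
  moreover have "computable (\<lambda>s. 2 ^ l s - 1)" by (intro comp_intros l)
  moreover have "computable (\<lambda>s. 0)" by (intro comp_intros)
  moreover have "measure cantor {X. C s (initial_val X (l s))} =
      (real (?a s) - real 0) / (real (2 ^ l s - 1) + 1)" for s
  proof -
    have "real (2 ^ l s - 1) + 1 = 2 ^ l s" by (simp add: of_nat_diff)
    then show ?thesis unfolding measure_initial_val_sum by simp
  qed
  ultimately show ?thesis using approx unfolding computable_real_def
    by (intro exI[of _ ?a] exI[of _ "\<lambda>s. 0"] exI[of _ "\<lambda>s. 2 ^ l s - 1"] conjI allI) (assumption | simp only:)+
qed

lemma strict_mono_add_sum: "strict_mono (\<lambda>s. s + (\<Sum>r<Suc s. h r :: nat))"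
  by (rule strict_mono_Suc_iff[THEN iffD2]) simp

section \<open>From a Schnorr test to a bounded set containing all tails\<close>

lemma tail_image_initial_val:
  "tail k ` {Z. Q (initial_val Z (k + L))} = {Y. \<exists>u<2 ^ k. Q (u + 2 ^ k * initial_val Y L)}"
proof (intro set_eqI iffI)
  fix Y assume "Y \<in> tail k ` {Z. Q (initial_val Z (k + L))}"
  then obtain Z where "Q (initial_val Z (k + L))" "Y = tail k Z" by auto
  then show "Y \<in> {Y. \<exists>u<2 ^ k. Q (u + 2 ^ k * initial_val Y L)}"
    using initial_val_less[of Z k] by (auto simp: initial_val_add)
next
  fix Y assume "Y \<in> {Y. \<exists>u<2 ^ k. Q (u + 2 ^ k * initial_val Y L)}"
  then obtain u where u: "u < 2 ^ k" "Q (u + 2 ^ k * initial_val Y L)" by auto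
  then obtain W where W: "initial_val W k = u" using initial_val_surj by blast
  define Z where "Z i = (if i < k then W i else Y (i - k))" for i
  have "initial_val Z k = u" unfolding W[symmetric] initial_val_def by (simp add: Z_def)
  moreover have "tail k Z = Y" by (simp add: tail_def Z_def)
  ultimately have "Q (initial_val Z (k + L))" "Y = tail k Z" using u by (auto simp: initial_val_add)
  then show "Y \<in> tail k ` {Z. Q (initial_val Z (k + L))}" by blast
qed

lemma measure_UN_geometric:
  assumes "\<And>k. A k \<in> sets cantor" "\<And>k. measure cantor (A k) \<le> (1 / 2) ^ (k + Suc s)"
  shows "measure cantor (\<Union>k. A k) \<le> (1 / 2) ^ s"
proof -
  have eq: "(\<lambda>k. (1 / 2 :: real) ^ (k + Suc s)) = (\<lambda>k. (1 / 2) ^ Suc s * (1 / 2) ^ k)"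
    by (simp add: power_add mult.commute)
  have sum: "(\<lambda>k. (1 / 2 :: real) ^ (k + Suc s)) sums ((1 / 2) ^ s)"
    unfolding eq using sums_mult[OF geometric_sums[of "1 / 2 :: real"], of "(1 / 2) ^ Suc s"] by simp
  have *: "summable (\<lambda>k. measure cantor (A k))"
    by (rule summable_comparison_test'[OF sums_summable[OF sum], of 0])
      (simp only: real_norm_def abs_of_nonneg[OF measure_nonneg] assms(2))
  have "measure cantor (\<Union>k. A k) \<le> (\<Sum>k. measure cantor (A k))"
    by (rule cantor.finite_measure_subadditive_countably) (use assms * in auto)
  also have "\<dots> \<le> (1 / 2) ^ s"
    using suminf_le[OF assms(2) * sums_summable[OF sum]] sums_unique[OF sum] by simp
  finally show ?thesis .
qed

text \<open>
  If \<open>X\<close> lies in all \<open>\<V> n\<close>, then its \<open>k\<close>-th tail lies in \<open>tail k ` \<V> n\<close>, whose measure is at most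
  \<open>2 ^ k * (1 / 2) ^ n\<close>.  Taking \<open>n = 3 * k + 2\<close> and the union over \<open>k\<close> gives a bounded open set that
  contains all tails of \<open>X\<close>.  Its measure is computable although images overlap: if for each \<open>k < s\<close>
  the set \<open>\<V> (3 * k + 2)\<close> is enumerated up to an error that is small compared to \<open>(1 / 2) ^ k\<close>, then the
  images of the finite parts miss only \<open>(1 / 2) ^ s\<close> of the union.
\<close>

lemma test_imp_tails:
  assumes test: "schnorr_test \<V>" and X: "X \<in> (\<Inter>n. \<V> n)"
  shows "\<exists>\<U>. schnorr_open \<U> \<and> bounded_open \<U> \<and> (\<forall>k. tail k X \<in> \<U>)"
proof -
  from test obtain U where U: "ce {prod_encode (n, str_code \<sigma>) |n \<sigma>. \<sigma> \<in> U n}"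
    "\<And>n. \<V> n = open_of (U n)" and \<mu>: "\<And>n. measure cantor (\<V> n) = (1 / 2) ^ n"
    by (auto simp: schnorr_test_def uniformly_ce_open_def)
  have "U 0 \<noteq> {}"
    using \<mu>[of 0] U(2)[of 0] by (auto simp: open_of_def)
  then have "{prod_encode (n, str_code \<sigma>) |n \<sigma>. \<sigma> \<in> U n} \<noteq> {}" by auto
  then obtain E where E: "computable E" "range E = {prod_encode (n, str_code \<sigma>) |n \<sigma>. \<sigma> \<in> U n}"
    using ce_enumeration[OF U(1)] by blast
  have approx: "\<bar>measure cantor (open_of (U n)) - (real 1 - real 0) / (real (2 ^ n - 1) + 1)\<bar> \<le> (1 / 2) ^ m" for n m
  proof -
    have "real (2 ^ n - 1) + 1 = 2 ^ n" by (simp add: of_nat_diff)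
    then have "(real 1 - real 0) / (real (2 ^ n - 1) + 1) = (1 / 2) ^ n" by (simp add: power_divide)
    then show ?thesis using \<mu>[of n] U(2)[of n] by simp
  qed
  have c: "computable2 (\<lambda>n m. 1)" "computable2 (\<lambda>n m. 0)" "computable2 (\<lambda>n m. 2 ^ n - 1)"
    by (intro comp_intros)+
  obtain T where T: "computable2 T" "\<And>n m. m \<le> T n m"
    "\<And>n m. measure cantor (open_of (U n)) \<le> measure cantor (open_of (stage E n (T n m))) + (1 / 2) ^ m"
    by (rule modulus_exists[OF E c approx]) (rule that)
  \<comment> \<open>With \<open>2 * k\<close> in place of \<open>3 * k\<close> the union would be bounded too; the extra \<open>k\<close> makes the sets with \<open>s \<le> k\<close> fit the same error bound as the finite ones.\<close>
  define N where "N k = 3 * k + 2" for k :: nat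
  define t where "t k s = T (N k) (s + 2 * k + 2)" for k s
  define S where "S k s = open_of (stage E (N k) (t k s))" for k s
  have S_sub: "S k s \<subseteq> \<V> (N k)" for k s
    unfolding S_def U(2) stage_union[OF E(2), symmetric] by (intro open_of_mono) blast
  define \<U> where "\<U> = (\<Union>k. tail k ` \<V> (N k))"
  define l where "l s = s + (\<Sum>r<Suc s. \<Sum>k<r. length_bound E (t k r))" for s
  have l: "length_bound E (t k s) \<le> k + l s" if "k < s" for k s
  proof -
    have "length_bound E (t k s) \<le> (\<Sum>k<s. length_bound E (t k s))"
      using that by (intro member_le_sum) auto
    also have "\<dots> \<le> (\<Sum>r<Suc s. \<Sum>k<r. length_bound E (t k r))"
      by simp
    finally show ?thesis by (simp add: l_def)
  qed
  \<comment> \<open>The \<open>u\<close> are the values of the \<open>k\<close> bits that may have been cut off.\<close>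
  define C where "C s v \<longleftrightarrow> (\<exists>k<s. \<exists>u<2 ^ k. stage_covers E (N k) (t k s) (k + l s) (u + 2 ^ k * v))" for s v
  have C_iff: "{Y. C s (initial_val Y (l s))} = (\<Union>k<s. tail k ` S k s)" for s
  proof -
    have "S k s = {Z. stage_covers E (N k) (t k s) (k + l s) (initial_val Z (k + l s))}" if "k < s" for k
      using stage_covers_iff[OF l[OF that]] by (auto simp: S_def)
    then show ?thesis by (auto simp: tail_image_initial_val C_def)
  qed
  have \<U>_eq: "\<U> = {Y. \<exists>s. C s (initial_val Y (l s))}"
  proof -
    have "(\<Union>s. \<Union>k<s. tail k ` S k s) = \<U>"
    proof (intro set_eqI iffI)
      fix Y assume "Y \<in> (\<Union>s. \<Union>k<s. tail k ` S k s)"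
      then show "Y \<in> \<U>" unfolding \<U>_def using S_sub by blast
    next
      fix Y assume "Y \<in> \<U>"
      then obtain k Z where Z: "Y = tail k Z" "Z \<in> \<V> (N k)" by (auto simp: \<U>_def)
      then obtain i where i: "Z \<in> open_of (stage E (N k) i)"
        unfolding U(2) stage_union[OF E(2), symmetric] open_of_UN by blast
      define s where "s = Suc (k + i)"
      have "i \<le> t k s" using T(2)[of "s + 2 * k + 2" "N k"] by (simp add: t_def s_def)
      then have "Z \<in> S k s" using i open_of_mono[OF stage_mono] unfolding S_def by blast
      moreover have "k < s" by (simp add: s_def)
      ultimately show "Y \<in> (\<Union>s. \<Union>k<s. tail k ` S k s)" using Z(1) by blast
    qed
    then show ?thesis unfolding C_iff[symmetric] by blast
  qed
  have decC: "decidable (\<lambda>e. C (f e) (g e))" if "computable f" "computable g" for f g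
    unfolding C_def l_def t_def N_def
    by (intro comp_intros decidable_stage_covers computable_length_bound computable2_comp[OF T(1)] E(1)
        that[THEN computable_comp])
  have comp_l: "computable (\<lambda>e. l (f e))" if "computable f" for f
    unfolding l_def t_def N_def
    by (intro comp_intros computable_length_bound computable2_comp[OF T(1)] E(1) that[THEN computable_comp])
  have sets_S: "S k s \<in> sets cantor" "\<V> k \<in> sets cantor" for k s
    by (simp_all add: S_def U(2) sets_open_of)
  have sets_U: "\<U> \<in> sets cantor"
    unfolding \<U>_def using tail_image sets_S by blast
  have err: "measure cantor (\<U> - (\<Union>k<s. tail k ` S k s)) \<le> (1 / 2) ^ Suc s" for s
  proof -
    define B where "B k = (if k < s then \<V> (N k) - S k s else \<V> (N k))" for k
    have B: "B k \<in> sets cantor" for k using sets_S by (auto simp: B_def)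
    have "measure cantor (B k) \<le> (1 / 2) ^ (s + 2 * k + 2)" for k
    proof (cases "k < s")
      case True
      have "measure cantor (\<V> (N k) - S k s) = measure cantor (\<V> (N k)) - measure cantor (S k s)"
        by (rule cantor.finite_measure_Diff) (use sets_S S_sub in auto)
      then show ?thesis using T(3)[of "N k" "s + 2 * k + 2"] True by (simp add: B_def S_def t_def U(2))
    next
      case False
      then have "(1 / 2 :: real) ^ N k \<le> (1 / 2) ^ (s + 2 * k + 2)"
        by (intro power_decreasing) (auto simp: N_def)
      then show ?thesis using False \<mu> by (simp add: B_def)
    qed
    then have "2 ^ k * measure cantor (B k) \<le> 2 ^ k * (1 / 2) ^ (s + 2 * k + 2)" for k by simp
    also have "2 ^ k * (1 / 2 :: real) ^ (s + 2 * k + 2) = (1 / 2) ^ (k + Suc (Suc s))" for k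
    proof -
      have "(1 / 2 :: real) ^ (s + 2 * k + 2) = (1 / 2) ^ k * (1 / 2) ^ (k + Suc (Suc s))"
        unfolding power_add[symmetric] by (rule arg_cong[of _ _ "power (1 / 2)"]) simp
      moreover have "2 ^ k * (1 / 2 :: real) ^ k = 1" by (simp add: power_mult_distrib[symmetric])
      ultimately show ?thesis by (metis mult.assoc mult_1)
    qed
    finally have "measure cantor (tail k ` B k) \<le> (1 / 2) ^ (k + Suc (Suc s))" for k
      using tail_image[OF B, of k k] by (meson order_trans)
    then have "measure cantor (\<Union>k. tail k ` B k) \<le> (1 / 2) ^ Suc s"
      using tail_image[OF B] by (intro measure_UN_geometric) auto
    moreover have "\<U> - (\<Union>k<s. tail k ` S k s) \<subseteq> (\<Union>k. tail k ` B k)"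
    proof
      fix Y assume Y: "Y \<in> \<U> - (\<Union>k<s. tail k ` S k s)"
      then obtain k Z where Z: "Y = tail k Z" "Z \<in> \<V> (N k)" by (auto simp: \<U>_def)
      have "Z \<in> B k" using Y Z by (auto simp: B_def)
      then show "Y \<in> (\<Union>k. tail k ` B k)" using Z(1) by blast
    qed
    then have "measure cantor (\<U> - (\<Union>k<s. tail k ` S k s)) \<le> measure cantor (\<Union>k. tail k ` B k)"
      using tail_image[OF B] by (intro cantor.finite_measure_mono) auto
    ultimately show ?thesis by simp
  qed
  have "ce_open \<U>"
  proof -
    have "decidable3 (\<lambda>n s v. C s v)" by (intro decC comp_intros)
    moreover have "computable2 (\<lambda>n s. l s)" by (intro comp_l comp_intros)
    moreover have "strict_mono l" unfolding l_def by (rule strict_mono_add_sum)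
    ultimately have "uniformly_ce_open (\<lambda>n::nat. {Y. \<exists>s. C s (initial_val Y (l s))})"
      by (rule uniformly_ce_open_stages[of "\<lambda>n s v. C s v" "\<lambda>n s. l s"])
    from ce_open_section[OF this] show ?thesis by (simp add: \<U>_eq)
  qed
  moreover have "computable_real (measure cantor \<U>)"
  proof (rule computable_real_stages[of C l])
    fix s
    have sub: "{Y. C s (initial_val Y (l s))} \<subseteq> \<U>" by (auto simp: \<U>_eq)
    have "measure cantor \<U> - measure cantor {Y. C s (initial_val Y (l s))} = measure cantor (\<U> - {Y. C s (initial_val Y (l s))})"
      by (rule cantor.finite_measure_Diff[symmetric]) (use sets_U sub sets_initial_val in auto)
    moreover have "\<dots> \<le> (1 / 2) ^ Suc s" using err[of s] by (simp add: C_iff)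
    moreover have "(1 / 2 :: real) ^ Suc s \<le> (1 / 2) ^ s" by (simp add: power_decreasing)
    moreover have "measure cantor {Y. C s (initial_val Y (l s))} \<le> measure cantor \<U>"
      using sub sets_U by (intro cantor.finite_measure_mono)
    ultimately show "\<bar>measure cantor \<U> - measure cantor {Y. C s (initial_val Y (l s))}\<bar> \<le> (1 / 2) ^ s"
      by linarith
  qed (intro decC comp_l[of "\<lambda>z. z", simplified] comp_intros)+
  moreover have "bounded_open \<U>"
    using err[of 0] by (simp add: bounded_open_def)
  moreover have "tail k X \<in> \<U>" for k
    using X by (auto simp: \<U>_def)
  ultimately show ?thesis by (auto simp: schnorr_open_def)
qed

section \<open>Padding to an exact measure\<close>

text \<open>
  The chain used for padding: \<open>lex_below L c\<close> consists of the \<open>c\<close> lexicographically first cylinders of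
  length \<open>L\<close>, so it is an initial segment of Cantor space of measure \<open>c / 2 ^ L\<close> (for \<open>c \<le> 2 ^ L\<close>).
  The rank reads the bits with the most significant one first, opposite to \<open>initial_val\<close>, because only
  this order makes the initial segments of different levels comparable.
\<close>

primrec lex_rank :: "(nat \<Rightarrow> bool) \<Rightarrow> nat \<Rightarrow> nat" where
  "lex_rank X 0 = 0"
| "lex_rank X (Suc L) = 2 * lex_rank X L + of_bool (X L)"

definition lex_below :: "nat \<Rightarrow> nat \<Rightarrow> (nat \<Rightarrow> bool) set" where
  "lex_below L c = {X. lex_rank X L < c}"

definition val_lex_rank :: "nat \<Rightarrow> nat \<Rightarrow> nat" where
  "val_lex_rank v L = rec_nat 0 (\<lambda>i r. 2 * r + v div 2 ^ i mod 2) L"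

lemma computable_val_lex_rank [comp_intros]:
  assumes "computable v" "computable L"
  shows "computable (\<lambda>z. val_lex_rank (v z) (L z))"
  unfolding val_lex_rank_def by (intro comp_intros assms assms[THEN computable_comp])

lemma val_lex_rank_initial_val: "L \<le> N \<Longrightarrow> val_lex_rank (initial_val X N) L = lex_rank X L"
proof (induction L)
  case (Suc L)
  have "initial_val X N div 2 ^ L mod 2 = initial_val (tail L X) (N - L) mod 2 ^ 1"
    using Suc.prems by (simp add: initial_val_div)
  also have "\<dots> = initial_val (tail L X) 1" using Suc.prems by (intro initial_val_mod) simp
  also have "\<dots> = of_bool (X L)" by (simp add: initial_val_def tail_def)
  finally show ?case using Suc by (simp add: val_lex_rank_def)
qed (simp add: val_lex_rank_def)

lemma lex_rank_less: "lex_rank X L < 2 ^ L"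
  by (induction L) auto

lemma lex_rank_inj: "lex_rank X L = lex_rank Y L \<Longrightarrow> initial X L = initial Y L"
proof (induction L)
  case (Suc L)
  have "2 * lex_rank X L + of_bool (X L) = 2 * lex_rank Y L + of_bool (Y L)" using Suc.prems by simp
  then have "lex_rank X L = lex_rank Y L" "X L = Y L" by (auto simp: of_bool_def split: if_splits) presburger+
  then show ?case using Suc.IH by (simp add: initial_def)
qed (simp add: initial_def)

lemma sets_lex_below [measurable]: "lex_below L c \<in> sets cantor"
  using sets_initial_val[of "\<lambda>v. val_lex_rank v L < c" L] by (simp add: lex_below_def val_lex_rank_initial_val)

lemma lex_below_0: "lex_below L 0 = {}"
  by (simp add: lex_below_def)

lemma lex_below_top: "lex_below L (2 ^ L) = UNIV"
  by (simp add: lex_below_def lex_rank_less)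

lemma lex_below_mono: "c \<le> d \<Longrightarrow> lex_below L c \<subseteq> lex_below L d"
  by (auto simp: lex_below_def)

lemma lex_below_Suc_level: "lex_below (Suc L) (2 * c) = lex_below L c"
  by (auto simp: lex_below_def of_bool_def)

lemma measure_lex_below_Suc: "measure cantor (lex_below L (Suc c) - lex_below L c) \<le> (1 / 2) ^ L"
proof (cases "\<exists>Y. lex_rank Y L = c")
  case True
  then obtain Y where "lex_rank Y L = c" ..
  have "X \<in> cylinder (initial Y L)" if "X \<in> lex_below L (Suc c) - lex_below L c" for X
  proof -
    have "lex_rank X L = lex_rank Y L" using that \<open>lex_rank Y L = c\<close> by (simp add: lex_below_def)
    from lex_rank_inj[OF this] show ?thesis by (simp add: mem_cylinder_iff)
  qed
  then have "lex_below L (Suc c) - lex_below L c \<subseteq> cylinder (initial Y L)" by blast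
  then have "measure cantor (lex_below L (Suc c) - lex_below L c) \<le> measure cantor (cylinder (initial Y L))"
    by (intro cantor.finite_measure_mono) auto
  then show ?thesis by (simp add: measure_cylinder)
next
  case False
  then have empty: "lex_below L (Suc c) - lex_below L c = {}" by (auto simp: lex_below_def less_Suc_eq)
  show ?thesis unfolding empty by simp
qed

text \<open>
  Padding \<open>V\<close> by the longest lexicographic initial segment that does not push the measure above \<open>\<epsilon>\<close>.
  Only conditions of the form ``the measure of an open set is less than \<open>\<epsilon>\<close>'' occur, and these can be
  verified in finite time when the measure of \<open>V\<close> is computable.
\<close>

definition pad :: "(nat \<Rightarrow> bool) set \<Rightarrow> real \<Rightarrow> (nat \<Rightarrow> bool) set" where
  "pad V \<epsilon> = V \<union> (\<Union>{lex_below L c |L c. measure cantor (V \<union> lex_below L c) < \<epsilon>})"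

text \<open>
  At level \<open>L\<close> let \<open>d L\<close> be the last rank that keeps the measure below \<open>\<epsilon>\<close>.  The next rank adds at most
  \<open>(1 / 2) ^ L\<close> and reaches \<open>\<epsilon>\<close>, so the measures at rank \<open>d L\<close> converge to \<open>\<epsilon>\<close>; and the corresponding sets
  increase to the padded set.
\<close>

lemma measure_pad:
  assumes V: "V \<in> sets cantor" and small: "measure cantor V < \<epsilon>" and \<epsilon>: "\<epsilon> \<le> 1"
  shows "measure cantor (pad V \<epsilon>) = \<epsilon>"
proof -
  let ?f = "\<lambda>L c. measure cantor (V \<union> lex_below L c)"
  have sets: "V \<union> lex_below L c \<in> sets cantor" for L c using V by simp
  have mono: "?f L c \<le> ?f L d" if "c \<le> d" for L c d
    using lex_below_mono[OF that] sets by (intro cantor.finite_measure_mono) auto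
  have "\<exists>c. ?f L c < \<epsilon> \<and> \<not> ?f L (Suc c) < \<epsilon>" for L
  proof (rule ccontr)
    assume "\<not> ?thesis"
    then have succ: "?f L (Suc c) < \<epsilon>" if "?f L c < \<epsilon>" for c using that by blast
    have "?f L c < \<epsilon>" for c
      by (induction c) (use small succ in \<open>auto simp: lex_below_0\<close>)
    from this[of "2 ^ L"] show False using \<epsilon> cantor.prob_space by (simp add: lex_below_top)
  qed
  then obtain d where d: "\<And>L. ?f L (d L) < \<epsilon>" "\<And>L. \<not> ?f L (Suc (d L)) < \<epsilon>" by metis
  have le_d: "c \<le> d L" if "?f L c < \<epsilon>" for L c
  proof (rule ccontr)
    assume "\<not> c \<le> d L"
    then show False using mono[of "Suc (d L)" c L] d(2)[of L] that by simp
  qed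
  have inc: "incseq (\<lambda>L. V \<union> lex_below L (d L))"
  proof (rule incseq_SucI)
    fix L
    have "2 * d L \<le> d (Suc L)"
      by (rule le_d) (use d(1)[of L] in \<open>simp add: lex_below_Suc_level\<close>)
    then have "lex_below L (d L) \<subseteq> lex_below (Suc L) (d (Suc L))"
      using lex_below_mono lex_below_Suc_level by metis
    then show "V \<union> lex_below L (d L) \<subseteq> V \<union> lex_below (Suc L) (d (Suc L))" by blast
  qed
  have "pad V \<epsilon> = (\<Union>L. V \<union> lex_below L (d L))"
    unfolding pad_def using d(1) le_d lex_below_mono by fast
  then have lim: "(\<lambda>L. ?f L (d L)) \<longlonglongrightarrow> measure cantor (pad V \<epsilon>)"
    using cantor.finite_Lim_measure_incseq[OF _ inc] sets by auto
  have lower: "\<epsilon> - (1 / 2) ^ L \<le> ?f L (d L)" for L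
  proof -
    have "?f L (Suc (d L)) \<le> measure cantor ((V \<union> lex_below L (d L)) \<union> (lex_below L (Suc (d L)) - lex_below L (d L)))"
      using V by (intro cantor.finite_measure_mono) auto
    also have "\<dots> \<le> ?f L (d L) + measure cantor (lex_below L (Suc (d L)) - lex_below L (d L))"
      using V by (intro measure_Un_le) auto
    also have "\<dots> \<le> ?f L (d L) + (1 / 2) ^ L" using measure_lex_below_Suc by simp
    finally show ?thesis using d(2)[of L] by simp
  qed
  have "(\<lambda>L. \<epsilon> - (1 / 2) ^ L) \<longlonglongrightarrow> \<epsilon>"
    using tendsto_diff[OF tendsto_const LIMSEQ_power_zero[of "1 / 2 :: real"], of \<epsilon>] by simp
  from tendsto_sandwich[OF _ _ this tendsto_const, of "\<lambda>L. ?f L (d L)"]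
  have "(\<lambda>L. ?f L (d L)) \<longlonglongrightarrow> \<epsilon>"
    using lower d(1) by (simp add: less_imp_le)
  then show ?thesis using lim LIMSEQ_unique by blast
qed

text \<open>
  A segment admitted for the smaller bound has measure less than \<open>\<epsilon> / 2\<close> itself.  Together with the
  set \<open>V\<close> of measure at most \<open>\<epsilon> / 2\<close> it still stays below \<open>\<epsilon>\<close>.
\<close>

lemma pad_decreasing:
  assumes "V' \<subseteq> V" and V: "V \<in> sets cantor" "V' \<in> sets cantor" and "measure cantor V \<le> \<epsilon> / 2"
  shows "pad V' (\<epsilon> / 2) \<subseteq> pad V \<epsilon>"
proof -
  have "measure cantor (V \<union> lex_below L c) < \<epsilon>" if "measure cantor (V' \<union> lex_below L c) < \<epsilon> / 2" for L c
  proof -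
    have "measure cantor (lex_below L c) \<le> measure cantor (V' \<union> lex_below L c)"
      using V by (intro cantor.finite_measure_mono) auto
    moreover have "measure cantor (V \<union> lex_below L c) \<le> measure cantor V + measure cantor (lex_below L c)"
      using V by (intro measure_Un_le) auto
    ultimately show ?thesis using that assms(4) by simp
  qed
  then show ?thesis using assms(1) unfolding pad_def by blast
qed

abbreviation decidable4 :: "(nat \<Rightarrow> nat \<Rightarrow> nat \<Rightarrow> nat \<Rightarrow> bool) \<Rightarrow> bool" where
  "decidable4 P \<equiv> decidable (\<lambda>e. P (pfst e) (pfst (psnd e)) (pfst (psnd (psnd e))) (psnd (psnd (psnd e))))"

lemma decidable4_comp:
  assumes "decidable4 P" "computable f" "computable g" "computable h" "computable k"
  shows "decidable (\<lambda>z. P (f z) (g z) (h z) (k z))"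
  using decidable_comp[OF assms(1) computable_pair[OF assms(2) computable_pair[OF assms(3) computable_pair[OF assms(4,5)]]]]
  by simp

text \<open>
  The definition of a Schnorr test asks for measure exactly \<open>(1 / 2) ^ n\<close>, which is awkward to arrange
  by hand.  Padding turns decreasing open sets of computable measure that are small enough into a
  test.  Here \<open>D n s L v\<close> decides the finite stage \<open>S n s\<close> of \<open>V n\<close> from the value \<open>v\<close> of any \<open>L\<close> bits with
  \<open>h n s \<le> L\<close>, and stage \<open>s\<close> misses at most \<open>(1 / 2) ^ s\<close>.
\<close>

lemma test_of_small_open_sets:
  fixes V :: "nat \<Rightarrow> (nat \<Rightarrow> bool) set"
  assumes D: "decidable4 D" and h: "computable2 h"
    and D_iff: "\<And>n s L X. h n s \<le> L \<Longrightarrow> D n s L (initial_val X L) \<longleftrightarrow> X \<in> S n s"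
    and union: "\<And>n. V n = (\<Union>s. S n s)"
    and approx: "\<And>n s. measure cantor (V n) \<le> measure cantor (S n s) + (1 / 2) ^ s"
    and dec: "decseq V" and small: "\<And>n. measure cantor (V n) \<le> (1 / 2) ^ Suc n"
  shows "\<exists>\<W>. schnorr_test \<W> \<and> (\<forall>n. V n \<subseteq> \<W> n)"
proof -
  define \<W> where "\<W> n = pad (V n) ((1 / 2) ^ n)" for n
  have sets_S: "S n s \<in> sets cantor" for n s
    using sets_initial_val[of "D n s (h n s)" "h n s"] D_iff[of n s "h n s"] by simp
  then have sets_V: "V n \<in> sets cantor" for n unfolding union by auto
  have meas: "measure cantor (\<W> n) = (1 / 2) ^ n" for n
    unfolding \<W>_def
  proof (rule measure_pad)
    have "measure cantor (V n) \<le> (1 / 2) ^ n / 2" using small[of n] by simp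
    also have "\<dots> < (1 / 2) ^ n" by simp
    finally show "measure cantor (V n) < (1 / 2) ^ n" .
  qed (use sets_V in \<open>auto simp: power_le_one\<close>)
  have "\<W> (Suc n) \<subseteq> \<W> n" for n
    using pad_decreasing[of "V (Suc n)" "V n" "(1 / 2) ^ n"] decseqD[OF dec, of n "Suc n"] sets_V small[of n]
    by (simp add: \<W>_def)
  then have decW: "decseq \<W>" by (rule decseq_SucI)
  define cnt where "cnt n s L c = (\<Sum>v<2 ^ (L + h n s). of_bool (D n s (L + h n s) v \<or> val_lex_rank v L < c) :: nat)"
    for n s L c
  \<comment> \<open>Cleared of denominators: at precision \<open>s\<close>, the segment \<open>lex_below L c\<close> is certified to be admissible.\<close>
  define good where "good n s L c \<longleftrightarrow> cnt n s L c * (2 ^ s * 2 ^ n) + 2 ^ (L + h n s) * 2 ^ n <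
    2 ^ (L + h n s) * (2 ^ s :: nat)" for n s L c
  have cnt: "measure cantor (S n s \<union> lex_below L c) = real (cnt n s L c) / 2 ^ (L + h n s)" for n s L c
  proof -
    have "S n s \<union> lex_below L c = {X. D n s (L + h n s) (initial_val X (L + h n s)) \<or> val_lex_rank (initial_val X (L + h n s)) L < c}"
      using D_iff[of n s "L + h n s"] by (auto simp: lex_below_def val_lex_rank_initial_val)
    then show ?thesis
      using measure_initial_val_sum[of "\<lambda>v. D n s (L + h n s) v \<or> val_lex_rank v L < c" "L + h n s"]
      by (simp only: cnt_def)
  qed
  have good_iff: "good n s L c \<longleftrightarrow> measure cantor (S n s \<union> lex_below L c) + (1 / 2) ^ s < (1 / 2) ^ n" for n s L c
  proof -
    define P where "P = (2::real) ^ (L + h n s)"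
    define Q where "Q = (2::real) ^ s"
    define R where "R = (2::real) ^ n"
    define k where "k = real (cnt n s L c)"
    have pos: "P > 0" "Q > 0" "R > 0" by (auto simp: P_def Q_def R_def)
    have scale: "x < y \<longleftrightarrow> x / z < y / z" if "z > 0" for x y z :: real
      using that by (simp add: divide_less_cancel)
    have "good n s L c \<longleftrightarrow> real (cnt n s L c * (2 ^ s * 2 ^ n) + 2 ^ (L + h n s) * 2 ^ n) <
      real (2 ^ (L + h n s) * 2 ^ s)"
      unfolding good_def by (simp only: of_nat_less_iff)
    also have "\<dots> \<longleftrightarrow> k * (Q * R) + P * R < P * Q"
      by (simp only: P_def Q_def R_def k_def of_nat_mult of_nat_add of_nat_power of_nat_numeral)
    also have "\<dots> \<longleftrightarrow> (k * (Q * R) + P * R) / (P * Q * R) < (P * Q) / (P * Q * R)"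
      by (rule scale) (use pos in auto)
    also have "(k * (Q * R) + P * R) / (P * Q * R) = k / P + 1 / Q"
      using pos by (simp add: add_divide_distrib)
    also have "(P * Q) / (P * Q * R) = 1 / R"
      using pos by simp
    also have "1 / Q = (1 / 2) ^ s" by (simp add: Q_def power_divide)
    also have "1 / R = (1 / 2) ^ n" by (simp add: R_def power_divide)
    finally show ?thesis unfolding cnt k_def P_def .
  qed
  have good_ex: "(\<exists>s. good n s L c) \<longleftrightarrow> measure cantor (V n \<union> lex_below L c) < (1 / 2) ^ n" for n L c
  proof
    assume "\<exists>s. good n s L c"
    then obtain s where s: "measure cantor (S n s \<union> lex_below L c) + (1 / 2) ^ s < (1 / 2) ^ n"
      unfolding good_iff by auto
    have "S n s \<subseteq> V n" unfolding union by blast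
    then have "V n \<union> lex_below L c = (S n s \<union> lex_below L c) \<union> (V n - S n s)" by blast
    also have "measure cantor \<dots> \<le> measure cantor (S n s \<union> lex_below L c) + measure cantor (V n - S n s)"
      using sets_V sets_S by (intro measure_Un_le) auto
    also have "measure cantor (V n - S n s) = measure cantor (V n) - measure cantor (S n s)"
      using sets_V sets_S \<open>S n s \<subseteq> V n\<close> by (intro cantor.finite_measure_Diff) auto
    finally show "measure cantor (V n \<union> lex_below L c) < (1 / 2) ^ n" using s approx[of n s] by simp
  next
    assume *: "measure cantor (V n \<union> lex_below L c) < (1 / 2) ^ n"
    obtain s where "(1 / 2) ^ s < (1 / 2) ^ n - measure cantor (V n \<union> lex_below L c)"
      using real_arch_pow_inv[of "(1 / 2) ^ n - measure cantor (V n \<union> lex_below L c)" "1 / 2"] * by auto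
    moreover have "measure cantor (S n s \<union> lex_below L c) \<le> measure cantor (V n \<union> lex_below L c)"
      using sets_V unfolding union by (intro cantor.finite_measure_mono) auto
    ultimately show "\<exists>s. good n s L c" unfolding good_iff by (intro exI[of _ s]) simp
  qed
  define l where "l n s = s + (\<Sum>r<Suc s. h n r + pfst r)" for n s
  have l: "h n s \<le> l n s" "pfst s \<le> l n s" for n s
    by (simp_all add: l_def)
  \<comment> \<open>stage \<open>s\<close> encodes a triple: a level, a lex_rank at that level and the precision of the test\<close>
  define C where "C n s v \<longleftrightarrow> D n s (l n s) v \<or>
    good n (psnd (psnd s)) (pfst s) (pfst (psnd s)) \<and> val_lex_rank v (pfst s) < pfst (psnd s)" for n s v
  have W_eq: "\<W> n = {X. \<exists>s. C n s (initial_val X (l n s))}" for n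
  proof -
    have C_iff: "C n s (initial_val X (l n s)) \<longleftrightarrow> X \<in> S n s \<or>
        good n (psnd (psnd s)) (pfst s) (pfst (psnd s)) \<and> X \<in> lex_below (pfst s) (pfst (psnd s))" for s X
      using D_iff[OF l(1)] val_lex_rank_initial_val[OF l(2)] by (simp add: C_def lex_below_def)
    have "X \<in> \<W> n \<longleftrightarrow> (\<exists>s. X \<in> S n s) \<or> (\<exists>L c s. good n s L c \<and> X \<in> lex_below L c)" for X
    proof -
      have "X \<in> V n \<longleftrightarrow> (\<exists>s. X \<in> S n s)" by (simp add: union)
      moreover have "X \<in> \<W> n \<longleftrightarrow> X \<in> V n \<or> (\<exists>L c. (\<exists>s. good n s L c) \<and> X \<in> lex_below L c)"
        unfolding \<W>_def pad_def good_ex by blast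
      ultimately show ?thesis by blast
    qed
    moreover have "(\<exists>s. X \<in> S n s) \<or> (\<exists>L c s. good n s L c \<and> X \<in> lex_below L c) \<longleftrightarrow>
        (\<exists>s. C n s (initial_val X (l n s)))" for X
      unfolding C_iff by (metis pfst_pair psnd_pair)
    ultimately show ?thesis by blast
  qed
  have "decidable3 C"
    unfolding C_def good_def cnt_def l_def
    by (intro comp_intros decidable4_comp[OF D] computable2_comp[OF h])
  moreover have "computable2 l"
    unfolding l_def by (intro comp_intros computable2_comp[OF h])
  moreover have "strict_mono (l n)" for n
    unfolding l_def by (rule strict_mono_add_sum)
  ultimately have "uniformly_ce_open (\<lambda>n. {X. \<exists>s. C n s (initial_val X (l n s))})"
    by (rule uniformly_ce_open_stages)
  then have "uniformly_ce_open \<W>" by (simp add: W_eq[symmetric])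
  then have "schnorr_test \<W>" using decW meas by (simp add: schnorr_test_def)
  moreover have "V n \<subseteq> \<W> n" for n by (auto simp: \<W>_def pad_def)
  ultimately show ?thesis by blast
qed

section \<open>Powers of a prefix-free set\<close>

text \<open>
  The open set generated by the concatenations of \<open>m\<close> strings of \<open>S\<close>, described through the sequences in
  it instead of the strings.
\<close>

primrec open_power :: "bool list set \<Rightarrow> nat \<Rightarrow> (nat \<Rightarrow> bool) set" where
  "open_power S 0 = UNIV"
| "open_power S (Suc m) = {X. \<exists>j. initial X j \<in> S \<and> tail j X \<in> open_power S m}"

lemma sets_open_power [measurable]: "open_power S m \<in> sets cantor"
  by (induction m) (use sets.top[of cantor] in \<open>auto intro: sets_prefix_tail\<close>)

lemma measure_open_power:
  "prefix_free S \<Longrightarrow> measure cantor (open_power S m) = measure cantor (open_of S) ^ m"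
  by (induction m) (use cantor.prob_space in \<open>auto simp: measure_prefix_tail sets_open_power\<close>)

lemma open_power_mono: "S \<subseteq> U \<Longrightarrow> open_power S m \<subseteq> open_power U m"
  by (induction m) auto

lemma open_power_Suc_subset: "open_power S (Suc m) \<subseteq> open_power S m"
proof (induction m)
  case (Suc m)
  then show ?case unfolding open_power.simps(2)[of S "Suc m"] open_power.simps(2)[of S m] by blast
qed simp

lemma open_power_antimono: "m \<le> m' \<Longrightarrow> open_power S m' \<subseteq> open_power S m"
  using decseqD[OF decseq_SucI[of "open_power S"]] open_power_Suc_subset by blast

lemma power_diff_le:
  fixes u q :: real
  assumes "0 \<le> u" "u \<le> q" "q \<le> 1"
  shows "q ^ m - u ^ m \<le> real m * (q - u)"
proof (induction m)
  case (Suc m)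
  have "q ^ Suc m - u ^ Suc m = q * (q ^ m - u ^ m) + u ^ m * (q - u)" by (simp add: algebra_simps)
  also have "q * (q ^ m - u ^ m) \<le> 1 * (q ^ m - u ^ m)"
    using assms power_mono[of u q m] by (intro mult_right_mono) auto
  also have "u ^ m * (q - u) \<le> 1 * (q - u)"
    using assms by (intro mult_right_mono power_le_one) auto
  finally show ?case using Suc by (simp add: algebra_simps)
qed simp

lemma open_power_union:
  assumes "mono S" "X \<in> open_power (\<Union>t. S t) m"
  shows "\<exists>t::nat. X \<in> open_power (S t) m"
  using assms(2)
proof (induction m arbitrary: X)
  case (Suc m)
  then obtain j t where j: "initial X j \<in> S t" "tail j X \<in> open_power (\<Union>t. S t) m" by auto
  from Suc.IH[OF j(2)] obtain t' where t': "tail j X \<in> open_power (S t') m" ..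
  have "S t \<subseteq> S (max t t')" "S t' \<subseteq> S (max t t')" 
    using monoD[OF assms(1), of t "max t t'"] monoD[OF assms(1), of t' "max t t'"] by simp_all
  then have "initial X j \<in> S (max t t')" "tail j X \<in> open_power (S (max t t')) m"
    using j(1) t' open_power_mono by blast+
  then show ?case by auto
qed simp

lemma omega_power_subset_open_power:
  assumes "X \<in> omega_power S"
  shows "X \<in> open_power S m"
proof -
  from assms obtain \<sigma> where \<sigma>: "\<And>i. \<sigma> i \<in> S" "\<And>n. X \<in> cylinder (concat (map \<sigma> [0..<n]))"
    by (auto simp: omega_power_def)
  define p where "p n = length (concat (map \<sigma> [0..<n]))" for n
  have p: "initial X (p n) = concat (map \<sigma> [0..<n])" for n
    using \<sigma>(2)[of n] by (simp add: mem_cylinder_iff p_def)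
  have "tail (p n) X \<in> open_power S m" for n
  proof (induction m arbitrary: n)
    case (Suc m)
    have p_Suc: "p (Suc n) = p n + length (\<sigma> n)" by (simp add: p_def)
    have "initial X (p n) @ initial (tail (p n) X) (length (\<sigma> n)) = initial X (p n) @ \<sigma> n"
      using p[of "Suc n"] p[of n] unfolding p_Suc initial_add by simp
    then have "initial (tail (p n) X) (length (\<sigma> n)) = \<sigma> n" by simp
    moreover have "tail (length (\<sigma> n)) (tail (p n) X) \<in> open_power S m"
      using Suc.IH[of "Suc n"] by (simp add: p_Suc)
    ultimately show ?case using \<sigma>(1)[of n] by (auto intro!: exI[of _ "length (\<sigma> n)"])
  qed simp
  from this[of 0] show ?thesis by (simp add: p_def)
qed

text \<open>
  Split off strings of \<open>S\<close> greedily: what remains is always a tail of \<open>X\<close>, hence starts with a string of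
  \<open>S\<close> again.
\<close>

lemma tails_imp_omega_power:
  assumes tails: "\<And>k. tail k X \<in> open_of S" and "[] \<notin> S"
  shows "X \<in> omega_power S"
proof -
  have "\<exists>j. initial (tail k X) j \<in> S" for k using tails[of k] by (simp add: mem_open_of_iff)
  then obtain j where j: "\<And>k. initial (tail k X) (j k) \<in> S" by metis
  define p where "p n = ((\<lambda>k. k + j k) ^^ n) 0" for n
  define \<sigma> where "\<sigma> n = initial (tail (p n) X) (j (p n))" for n
  have "j k \<noteq> 0" for k using j[of k] assms(2) by (cases "j k") (auto simp: initial_def)
  then have pos: "j k \<ge> 1" for k by (simp add: Suc_le_eq)
  have concat: "concat (map \<sigma> [0..<n]) = initial X (p n)" for n
  proof (induction n)
    case 0 then show ?case by (simp add: p_def initial_def)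
  next
    case (Suc n)
    have "p (Suc n) = p n + j (p n)" by (simp add: p_def)
    then show ?case using Suc by (simp add: initial_add \<sigma>_def)
  qed
  have "n \<le> p n" for n
  proof (induction n)
    case (Suc n)
    then show ?case using pos[of "p n"] by (simp add: p_def)
  qed simp
  then have "\<exists>n. m \<le> length (concat (map \<sigma> [0..<n]))" for m by (auto simp: concat)
  moreover have "X \<in> cylinder (concat (map \<sigma> [0..<n]))" for n
    by (simp add: concat mem_cylinder_iff)
  moreover have "\<sigma> n \<in> S" for n by (simp add: \<sigma>_def j)
  ultimately show ?thesis unfolding omega_power_def by blast
qed

text \<open>
  A prefix-free set admits at most one way to read strings from the front of a sequence.  So the
  members of \<open>open_power\<close> for a finite stage can be recognised by iterating the function that sends a
  position \<open>p\<close> to the end of the unique string starting at \<open>p\<close>.  The value \<open>L + 1\<close>, a position outside the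
  \<open>L\<close> bits \<open>v\<close>, signals failure and is preserved by further steps.
\<close>

definition next_cut :: "(nat \<Rightarrow> nat) \<Rightarrow> nat \<Rightarrow> nat \<Rightarrow> nat \<Rightarrow> nat \<Rightarrow> nat" where
  "next_cut E t L v p = (LEAST j. L < j \<or>
     p \<le> j \<and> (\<exists>i<t. E i = prod_encode (0, val_code (j - p) (v div 2 ^ p mod 2 ^ (j - p)))))"

definition cut_after :: "(nat \<Rightarrow> nat) \<Rightarrow> nat \<Rightarrow> nat \<Rightarrow> nat \<Rightarrow> nat \<Rightarrow> nat" where
  "cut_after E t m L v = rec_nat 0 (\<lambda>_ p. next_cut E t L v p) m"

lemma computable_cut_after:
  assumes "computable E" "computable t" "computable m" "computable L" "computable v"
  shows "computable (\<lambda>z. cut_after E (t z) (m z) (L z) (v z))"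
  unfolding cut_after_def next_cut_def
proof (intro comp_intros assms assms[THEN computable_comp])
  fix z
  show "\<exists>y. L (psnd (psnd z)) < y \<or> pfst (psnd z) \<le> y \<and>
      (\<exists>i<t (psnd (psnd z)). E i = prod_encode (0, val_code (y - pfst (psnd z))
         (v (psnd (psnd z)) div 2 ^ pfst (psnd z) mod 2 ^ (y - pfst (psnd z)))))"
    by (rule exI[of _ "Suc (L (psnd (psnd z)))"]) simp
qed

lemma rec_nat_funpow: "rec_nat x (\<lambda>_. f) m = (f ^^ m) x"
  by (induction m) auto

lemma next_cut_cond:
  assumes "p \<le> j" "j \<le> L"
  shows "(\<exists>i<t. E i = prod_encode (0, val_code (j - p) (initial_val X L div 2 ^ p mod 2 ^ (j - p)))) \<longleftrightarrow>
    initial (tail p X) (j - p) \<in> stage E 0 t"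
  using assms by (simp add: initial_val_div initial_val_mod stage_def str_code_initial)

lemma next_cut_iterate:
  assumes pf: "prefix_free (stage E 0 t)" and "p \<le> L" "p + m * length_bound E t \<le> L"
  shows "(next_cut E t L (initial_val X L) ^^ m) p \<le> L \<longleftrightarrow> tail p X \<in> open_power (stage E 0 t) m"
  using assms(2,3)
proof (induction m arbitrary: p)
  case (Suc m)
  let ?S = "stage E 0 t" and ?f = "next_cut E t L (initial_val X L)"
  show ?case
  proof (cases "\<exists>i. initial (tail p X) i \<in> ?S")
    case True
    then obtain i where i: "initial (tail p X) i \<in> ?S" ..
    have "i \<le> length_bound E t" using length_le_length_bound[OF i] by simp
    then have le: "p + i + m * length_bound E t \<le> L" using Suc.prems by simp
    have unique: "i' = i" if "initial (tail p X) i' \<in> ?S" for i'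
      using prefix_free_initial_unique[OF pf that i] .
    have "?f p = p + i"
      unfolding next_cut_def
    proof (rule Least_equality)
      show "L < p + i \<or> p \<le> p + i \<and> (\<exists>k<t. E k = prod_encode (0, val_code (p + i - p)
          (initial_val X L div 2 ^ p mod 2 ^ (p + i - p))))"
        using next_cut_cond[of p "p + i" L t E X] le i by simp
      fix y assume y: "L < y \<or> p \<le> y \<and> (\<exists>k<t. E k = prod_encode (0, val_code (y - p)
          (initial_val X L div 2 ^ p mod 2 ^ (y - p))))"
      show "p + i \<le> y"
      proof (cases "L < y")
        case True then show ?thesis using le by simp
      next
        case False
        then have "initial (tail p X) (y - p) \<in> ?S" "p \<le> y" using y next_cut_cond[of p y L t E X] by auto
        then show ?thesis using unique by auto
      qed
    qed
    then have "(?f ^^ Suc m) p \<le> L \<longleftrightarrow> (?f ^^ m) (p + i) \<le> L"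
      by (simp add: funpow_Suc_right del: funpow.simps)
    also have "\<dots> \<longleftrightarrow> tail (p + i) X \<in> open_power ?S m"
      using le by (intro Suc.IH) auto
    also have "\<dots> \<longleftrightarrow> tail p X \<in> open_power ?S (Suc m)"
      unfolding open_power.simps mem_Collect_eq tail_add using i unique by metis
    finally show ?thesis .
  next
    case False
    have out: "?f q = Suc L" if "q = p \<or> q = Suc L" for q
      unfolding next_cut_def
    proof (rule Least_equality)
      fix y assume y: "L < y \<or> q \<le> y \<and> (\<exists>k<t. E k = prod_encode (0, val_code (y - q)
          (initial_val X L div 2 ^ q mod 2 ^ (y - q))))"
      show "Suc L \<le> y"
      proof (rule ccontr)
        assume "\<not> Suc L \<le> y"
        then have le: "y \<le> L" "q \<le> y" using y by auto
        then have "q = p" using that by auto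
        then have "initial (tail p X) (y - p) \<in> ?S" using y le next_cut_cond[of p y L t E X] by simp
        then show False using False by blast
      qed
    qed simp
    have "(?f ^^ Suc m) p = Suc L" for m
      by (induction m) (simp_all add: out)
    then show ?thesis using False by auto
  qed
qed simp

text \<open>
  A member of \<open>U\<^sup>\<omega>\<close> lies in all powers of \<open>U\<close>, and the \<open>m\<close>-th power has measure \<open>q ^ m\<close> for the measure
  \<open>q < 1\<close> of \<open>U\<close>.  Powers with exponents \<open>\<kappa> * (n + 1)\<close>, where \<open>q ^ \<kappa> < 1 / 2\<close>, are small enough to be padded
  to a test.  The \<open>m\<close>-th power of a finite part of measure \<open>u\<close> misses \<open>q ^ m - u ^ m \<le> m * (q - u)\<close>, which
  gives the required control of the stages.
\<close>

lemma omega_power_imp_test: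
  assumes U: "schnorr_prefix_free U" "bounded_strings U" and X: "X \<in> omega_power U"
  shows "\<exists>\<W>. schnorr_test \<W> \<and> X \<in> (\<Inter>n. \<W> n)"
proof -
  let ?q = "measure cantor (open_of U)"
  have pf: "prefix_free U" and q: "?q < 1"
    using U by (auto simp: schnorr_prefix_free_def bounded_strings_def)
  have "U \<noteq> {}" using X by (auto simp: omega_power_def)
  then obtain f where f: "computable f" "range f = str_code ` U"
    using ce_enumeration[of "str_code ` U"] U(1) by (auto simp: schnorr_prefix_free_def ce_strings_def)
  \<comment> \<open>The family that is constantly \<open>U\<close>, to fit the uniform notion of a stage.\<close>
  define E where "E e = prod_encode (pfst e, f (psnd e))" for e
  have E: "computable E"
    unfolding E_def by (intro comp_intros computable_comp[OF f(1)])
  have rangeE: "range E = {prod_encode (n, str_code \<sigma>) |n \<sigma>. \<sigma> \<in> U}"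
  proof (intro set_eqI iffI)
    fix x assume "x \<in> range E"
    then obtain e where "x = E e" by blast
    moreover have "f (psnd e) \<in> str_code ` U" using f(2) by blast
    ultimately show "x \<in> {prod_encode (n, str_code \<sigma>) |n \<sigma>. \<sigma> \<in> U}" by (auto simp: E_def)
  next
    fix x assume "x \<in> {prod_encode (n, str_code \<sigma>) |n \<sigma>. \<sigma> \<in> U}"
    then obtain n \<sigma> where x: "x = prod_encode (n, str_code \<sigma>)" "\<sigma> \<in> U" by blast
    then obtain i where "f i = str_code \<sigma>" using f(2) by (metis imageI imageE)
    then have "x = E (prod_encode (n, i))" by (simp add: x E_def)
    then show "x \<in> range E" by blast
  qed
  obtain a b c where abc: "computable a" "computable b" "computable c"
    "\<And>m. \<bar>?q - (real (a m) - real (b m)) / (real (c m) + 1)\<bar> \<le> (1 / 2) ^ m"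
    using U(1) by (auto simp: schnorr_prefix_free_def computable_real_def)
  have abc2: "computable2 (\<lambda>n. a)" "computable2 (\<lambda>n. b)" "computable2 (\<lambda>n. c)"
    by (intro comp_intros abc(1-3)[THEN computable_comp])+
  obtain T where T: "computable2 T" "\<And>n m. m \<le> T n m"
    "\<And>n m. ?q \<le> measure cantor (open_of (stage E n (T n m))) + (1 / 2) ^ m"
    by (rule modulus_exists[of E "\<lambda>_. U", OF E rangeE abc2 abc(4)]) (rule that)
  obtain \<kappa> where \<kappa>: "?q ^ \<kappa> < 1 / 2"
    using real_arch_pow_inv[of "1 / 2" ?q] q by auto
  define M where "M n = \<kappa> * Suc n" for n
  \<comment> \<open>The additional precision \<open>M n\<close> pays for the factor \<open>M n \<le> 2 ^ M n\<close> in \<open>power_diff_le\<close>.\<close>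
  define t where "t n s = T 0 (s + M n)" for n s
  define S where "S n s = open_power (stage E 0 (t n s)) (M n)" for n s
  have stage_sub: "stage E 0 i \<subseteq> U" for i
    using stage_union[OF rangeE, of 0] by blast
  have pf_stage: "prefix_free (stage E 0 i)" for i
    using pf stage_sub[of i] unfolding prefix_free_def by blast
  define D where "D n s L v \<longleftrightarrow> cut_after E (t n s) (M n) L v \<le> L" for n s L v
  have "\<exists>\<W>. schnorr_test \<W> \<and> (\<forall>n. open_power U (M n) \<subseteq> \<W> n)"
  proof (rule test_of_small_open_sets)
    show "decidable4 D"
      unfolding D_def t_def M_def
      by (intro comp_intros computable_cut_after E computable2_comp[OF T(1)])
    show "computable2 (\<lambda>n s. M n * length_bound E (t n s))"
      unfolding t_def M_def by (intro comp_intros computable_length_bound E computable2_comp[OF T(1)])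
    show "D n s L (initial_val X L) \<longleftrightarrow> X \<in> S n s" if "M n * length_bound E (t n s) \<le> L" for n s L X
      using next_cut_iterate[OF pf_stage, of 0 L "M n" "t n s" X] that
      by (simp add: D_def S_def cut_after_def rec_nat_funpow)
    show "open_power U (M n) = (\<Union>s. S n s)" for n
    proof
      show "(\<Union>s. S n s) \<subseteq> open_power U (M n)"
        using open_power_mono[OF stage_sub] by (auto simp: S_def)
      show "open_power U (M n) \<subseteq> (\<Union>s. S n s)"
      proof
        fix Y assume "Y \<in> open_power U (M n)"
        then have Y: "Y \<in> open_power (\<Union>i. stage E 0 i) (M n)" by (simp add: stage_union[OF rangeE])
        have "mono (stage E 0)" by (intro monoI stage_mono)
        from open_power_union[OF this Y] obtain i where i: "Y \<in> open_power (stage E 0 i) (M n)" ..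
        have "i \<le> t n i" using T(2)[of "i + M n" 0] by (simp add: t_def)
        then have "Y \<in> S n i" using i open_power_mono[OF stage_mono[OF \<open>i \<le> t n i\<close>]] unfolding S_def by blast
        then show "Y \<in> (\<Union>s. S n s)" by blast
      qed
    qed
    show "measure cantor (open_power U (M n)) \<le> measure cantor (S n s) + (1 / 2) ^ s" for n s
    proof -
      let ?u = "measure cantor (open_of (stage E 0 (t n s)))"
      have "?u \<le> ?q" using stage_sub by (intro cantor.finite_measure_mono open_of_mono) auto
      then have "?q ^ M n - ?u ^ M n \<le> real (M n) * (?q - ?u)"
        using q by (intro power_diff_le) auto
      also have "\<dots> \<le> 2 ^ M n * (1 / 2) ^ (s + M n)"
        using T(3)[of 0 "s + M n"] \<open>?u \<le> ?q\<close> of_nat_less_two_power[of "M n", where 'a = real]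
        by (intro mult_mono) (auto simp: t_def)
      also have "\<dots> = (1 / 2) ^ s"
        by (simp add: power_add power_mult_distrib[symmetric])
      finally show ?thesis
        by (simp add: measure_open_power pf pf_stage S_def)
    qed
    show "decseq (\<lambda>n. open_power U (M n))"
      by (intro decseq_SucI open_power_antimono) (simp add: M_def)
    show "measure cantor (open_power U (M n)) \<le> (1 / 2) ^ Suc n" for n
    proof -
      have "(?q ^ \<kappa>) ^ Suc n \<le> (1 / 2) ^ Suc n" using \<kappa> by (intro power_mono) auto
      then show ?thesis by (simp only: measure_open_power[OF pf] M_def power_mult)
    qed
  qed
  then show ?thesis using omega_power_subset_open_power[OF X] by blast
qed

section \<open>The equivalence\<close>

theorem theorem2p2:
  fixes X :: "nat \<Rightarrow> bool"
  shows "(\<not> schnorr_random X \<longleftrightarrow>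
            (\<exists>\<U>. schnorr_open \<U> \<and> bounded_open \<U> \<and> (\<forall>k. tail k X \<in> \<U>))) \<and>
         ((\<exists>\<U>. schnorr_open \<U> \<and> bounded_open \<U> \<and> (\<forall>k. tail k X \<in> \<U>)) \<longleftrightarrow>
            (\<exists>U. schnorr_prefix_free U \<and> bounded_strings U \<and> X \<in> omega_power U))"
    (is "(?i \<longleftrightarrow> ?ii) \<and> (?ii \<longleftrightarrow> ?iii)")
proof -
  have "?ii" if "?i"
    using that test_imp_tails unfolding schnorr_random_def by blast
  moreover have "?iii" if "?ii"
  proof -
    from that obtain U where U: "ce_strings U" "prefix_free U"
      "computable_real (measure cantor (open_of U))" "measure cantor (open_of U) < 1"
      "\<And>k. tail k X \<in> open_of U"
      by (auto simp: schnorr_open_def bounded_open_def ce_open_def)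
    have "[] \<notin> U"
    proof
      assume "[] \<in> U"
      then have "open_of U = UNIV" by (auto simp: open_of_def cylinder_def)
      then show False using U(4) cantor.prob_space by simp
    qed
    then have "X \<in> omega_power U" using U(5) by (rule tails_imp_omega_power[rotated])
    then show ?thesis using U by (auto simp: schnorr_prefix_free_def bounded_strings_def)
  qed
  moreover have "?i" if "?iii"
    using that omega_power_imp_test unfolding schnorr_random_def by blast
  ultimately show ?thesis by blast
qed

end
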